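(* There is an absolute constant $C>0$ such that the following holds (all implied constants in $\ll,\gg$ below are absolute). Let $G$ be a group acting on a set $X$, let $Y$ be a finite non-empty subset of $X$, and let $A$ be a finite non-empty subset of $G$. Given a number $0<\alpha<1$ and an integer $J\geq 1$, let $\alpha_J=2(\alpha/2)^{2^J}$ and define $K>0$ by $K=\left(|\mathrm{Sym}_{\alpha_J}(Y)|/|A|\right)^{1/J}$. If $A\subseteq \mathrm{Sym}_\alpha(Y)$, then: (1) there is an element $g_*\in A_{(2^J)}$ and a finite subset $A_*\subseteq G$ such that $g_*^{-1}A_*\subseteq A_{(2^J)}\cap \mathrm{Sym}_{\alpha_J}(Y)$ and $|A_*^3|\ll (K/\alpha_J)^C|A_*|$; (2) for any subset $S\subseteq G$ there is an element $g\in A_{(2^{J+1})}$ such that \[|A^{-1}\cap gS|+|A\cap gS|\gg \left(\frac{\alpha_J}{K}\right)^C\frac{|S\cap A_*|}{|A_*|}|A|;\] (3) for any subset $S\subseteq G$ such that $B:=A_*\cap S$ is non-empty, setting $\rho=|B|/|A_*|$, there is a subset $Y'\subseteq Y$ with \[|Y'|\geq \frac{\alpha_J|B|}{2|BB^{-1}|}|Y|\gg\left(\frac{\rho\,\alpha_J}{K}\right)^C|Y|,\] and a subset $Z\subseteq Y'$ such that $Y'\subseteq B^{-1}B(Z)$ and \[|Z|\leq \frac{2|Y|}{\alpha_J|B|}\left(1+\frac{1}{|B||Z|}\sum_{g\neq e}|\mathrm{fix}(g)\cap Z|\,r_{B^{-1}B}(g)\right)\ll\left(\frac{K}{\rho\,\alpha_J}\right)^C\frac{|Y|}{|S|}\left(1+\frac{1}{|S||Z|}\sum_{g\neq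 e}|\mathrm{fix}(g)\cap Z|\,r_{S^{-1}S}(g)\right).\]
   Context: $G$ acts on $X$ on the left. For $0<\beta\leq 1$ and finite $Y\subseteq X$, the symmetry set is $\mathrm{Sym}_\beta(Y)=\{g\in G\colon |Y\cap gY|\geq \beta|Y|\}$. For $A\subseteq G$, $A_{(k)}=(A\cup A^{-1}\cup\{e\})^k$ (the $k$-fold product set). For $B\subseteq G$ and $Z\subseteq X$, $B(Z)=\{b(z)\colon b\in B, z\in Z\}$; $BB^{-1}$, $B^{-1}B$, $A_*^3$ denote product sets. $\mathrm{fix}(g)=\{x\in X\colon gx=x\}$. For finite $B\subseteq G$ and $g\in G$, $r_{B^{-1}B}(g)=|\{(b_1,b_2)\in B\times B\colon b_1^{-1}b_2=g\}|=|B\cap Bg|$. Sums $\sum_{g\neq e}$ range over non-identity elements of $G$.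
   Formalization: The last ≪ in (3) is false as printed for large S (free actions); it is proved for finite S with K/(ρα_J) multiplied by max(1,|S|/|A_*|), unchanged when |S|≤|A_*|. C and the implied constants are stated per carrier type; one large type gives uniformity. *)

theory Defs
  imports "HOL-Algebra.Group_Action" "HOL-Analysis.Infinite_Sum"
begin

text \<open>A group \<open>G\<close> acting on \<open>X\<close> is the library locale \<open>group_action G X \<phi>\<close>; the translate \<open>gY\<close> is
  \<open>\<phi> g ` Y\<close>, and \<open>fix(g)\<close> is the library's \<open>invariants X \<phi> g\<close>.\<close>

definition sym_set :: "('g, 'm) monoid_scheme \<Rightarrow> ('g \<Rightarrow> 'x \<Rightarrow> 'x) \<Rightarrow> real \<Rightarrow> 'x set \<Rightarrow> 'g set" where
  "sym_set G \<phi> \<beta> Y = {g \<in> carrier G. real (card (Y \<inter> \<phi> g ` Y)) \<ge> \<beta> * real (card Y)}"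

definition act_image :: "('g \<Rightarrow> 'x \<Rightarrow> 'x) \<Rightarrow> 'g set \<Rightarrow> 'x set \<Rightarrow> 'x set" where
  "act_image \<phi> B Z = {\<phi> b z | b z. b \<in> B \<and> z \<in> Z}"

primrec set_power :: "('g, 'm) monoid_scheme \<Rightarrow> 'g set \<Rightarrow> nat \<Rightarrow> 'g set" where
  "set_power G A 0 = {\<one>\<^bsub>G\<^esub>}"
| "set_power G A (Suc k) = A <#>\<^bsub>G\<^esub> set_power G A k"

definition sym_power :: "('g, 'm) monoid_scheme \<Rightarrow> 'g set \<Rightarrow> nat \<Rightarrow> 'g set" where
  "sym_power G A k = set_power G (A \<union> set_inv\<^bsub>G\<^esub> A \<union> {\<one>\<^bsub>G\<^esub>}) k"

definition quot_reps :: "('g, 'm) monoid_scheme \<Rightarrow> 'g set \<Rightarrow> 'g \<Rightarrow> nat" where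
  "quot_reps G B g = card {(b1, b2) \<in> B \<times> B. inv\<^bsub>G\<^esub> b1 \<otimes>\<^bsub>G\<^esub> b2 = g}"

text \<open>The bracket \<open>1 + (|B||Z|)\<^sup>-\<^sup>1 \<Sum>\<^bsub>g \<noteq> e\<^esub> |fix(g) \<inter> Z| r(g)\<close> with \<open>r\<close> counting representations
  in \<open>B\<^sup>-\<^sup>1B\<close>. The group may be infinite, where \<open>sum\<close> would return 0, hence \<open>infsum\<close>; for
  finite \<open>B\<close> only finitely many terms are nonzero.\<close>

definition fix_bracket ::
    "('g, 'm) monoid_scheme \<Rightarrow> 'x set \<Rightarrow> ('g \<Rightarrow> 'x \<Rightarrow> 'x) \<Rightarrow> 'g set \<Rightarrow> 'x set \<Rightarrow> real" where
  "fix_bracket G X \<phi> B Z =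
     1 + 1 / (real (card B) * real (card Z)) *
       (\<Sum>\<^sub>\<infinity>g\<in>carrier G - {\<one>\<^bsub>G\<^esub>}. real (card (invariants X \<phi> g \<inter> Z)) * real (quot_reps G B g))"

text \<open>Conventions used in the theorem:
  \<^item> The constants \<open>C\<close> and \<open>M\<close> precede the quantifiers over groups, actions and sets, so they are
    absolute; \<open>f \<ll> g\<close> and \<open>g \<gg> f\<close> are both rendered as \<open>f \<le> M * g\<close>.
  \<^item> \<open>K\<close> is a real number, so the symmetry set whose size defines it is finite.
  \<^item> \<open>A\<^sub>*\<close> is non-empty, since the bounds divide by its size.
  \<^item> The last estimate divides by \<open>|S|\<close> and is stated for finite \<open>S\<close>. Its loss factor contains
    \<open>max 1 (|S| / |A\<^sub>*|)\<close>, which is 1 as soon as \<open>|S| \<le> |A\<^sub>*|\<close> (in particular for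
    \<open>S \<subseteq> A\<^sub>*\<close>). Without it the estimate fails: enlarging \<open>S\<close> outside \<open>A\<^sub>*\<close> changes neither
    \<open>B\<close> nor \<open>\<rho>\<close>, and for a free action the bracket is 1, so the bound would tend to 0 although
    \<open>|Z| \<ge> 1\<close>.\<close>

end

theory Submission
  imports Defs "HOL-Analysis.Convex"
begin

text \<open>
  Put \<open>\<alpha>\<^sub>j = 2(\<alpha>/2)\<^bsup>2^j\<^esup>\<close>, so that \<open>\<alpha>\<^sub>j\<^sub>+\<^sub>1 = \<alpha>\<^sub>j\<^sup>2/2\<close>. Start from the uniform measure \<open>\<mu>\<^sub>0\<close> on \<open>A \<union> A\<inverse>\<close> and let
  \<open>\<mu>\<^sub>j\<^sub>+\<^sub>1\<close> be the restriction of \<open>\<mu>\<^sub>j * \<mu>\<^sub>j\<close> to \<open>Sym\<close> at level \<open>\<alpha>\<^sub>j\<^sub>+\<^sub>1\<close>, normalised; by Cauchy--Schwarz at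
  least the fraction \<open>\<alpha>\<^sub>j\<^sub>+\<^sub>1\<close> of the mass survives. The squared \<open>L\<^sup>2\<close> norm drops by at most the factor \<open>K\<^sup>J\<close>
  over \<open>J\<close> steps, so in one step it drops by at most \<open>K\<close>, and there \<open>\<mu>\<^sub>j * \<mu>\<^sub>j\<close> has large energy. After
  discarding atypically large and small values of \<open>\<mu>\<^sub>j\<close>, the Balog--Szemeredi--Gowers theorem gives a
  translate of a subset of the support of \<open>\<mu>\<^sub>j\<close> with small tripling; this is \<open>A\<^sub>*\<close>. Working with
  measures rather than sets makes (2) lossless: \<open>\<mu>\<^sub>j\<close> is dominated by an average of translates of
  \<open>\<mu>\<^sub>0\<close>, up to the factor \<open>1/\<alpha>\<^sub>j\<^sub>+\<^sub>1\<close>.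

  For (3), let \<open>W = g\<^sub>*Y\<close>, let \<open>Y'\<close> be the set of \<open>y \<in> Y\<close> that many \<open>b \<in> B\<close> send into \<open>W\<close>, and let \<open>Z\<close> be a
  maximal subset of \<open>Y'\<close> for which the sets \<open>B(z) \<inter> W\<close> are disjoint; Cauchy--Schwarz bounds \<open>|Z|\<close> by the
  number of coincidences \<open>b\<^sub>1z = b\<^sub>2z\<close>, which is what the sum over fixed points counts.
\<close>

subsection \<open>The noncommutative Balog--Szemeredi--Gowers theorem\<close>

text \<open>Double counting of pairs formed by a product \<open>z\<close> in
  \<open>S <#> S <#> S\<close> and a triple of representations of its factors. Two outer elements of
  \<open>A\<close> and two middle quotients in \<open>Q\<close> determine such a pair, so there are
  at most |A|^2 |Q|^2 of them. Allowing the exceptional pairs \<open>bad\<close> costs a factor 2,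
  so it is enough that most quotients lie in \<open>Q\<close>.\<close>

lemma (in group) popular_quotients_tripling:
  fixes t :: real
  assumes A: "A \<subseteq> carrier G" "finite A" and Q: "finite Q" and bad: "bad \<subseteq> A \<times> A"
    and good: "\<And>a b. \<lbrakk>a \<in> A; b \<in> A; (a, b) \<notin> bad\<rbrakk> \<Longrightarrow> a \<otimes> inv b \<in> Q"
    and t: "0 < t" "real (card bad) \<le> t\<^sup>2 / 4"
    and S: "S \<subseteq> carrier G" "\<And>s. s \<in> S \<Longrightarrow> t \<le> real (quot_reps G A s)"
  shows "real (card (S <#> S <#> S)) * (t ^ 3 / 2) \<le> (real (card A))\<^sup>2 * (real (card Q))\<^sup>2"
    and "finite S"
proof -
  define R where "R s = {(a, b) \<in> A \<times> A. inv a \<otimes> b = s}" for s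
  have R_sub: "R s \<subseteq> A \<times> A" for s by (auto simp: R_def)
  have R_fin: "finite (R s)" for s by (rule finite_subset[OF R_sub]) (use A in auto)
  have R_fst: "fst p \<in> carrier G" "snd p \<in> carrier G" "fst p \<in> A" "snd p \<in> A" "snd p = fst p \<otimes> s"
    "fst p = snd p \<otimes> inv s" if pR: "p \<in> R s" for p s
  proof -
    obtain a b where p: "p = (a, b)" "a \<in> A" "b \<in> A" "inv a \<otimes> b = s"
      using pR by (auto simp: R_def)
    then have c: "a \<in> carrier G" "b \<in> carrier G" using A by auto
    then have "s \<in> carrier G" using p by auto
    then show "fst p \<in> carrier G" "snd p \<in> carrier G" "fst p \<in> A" "snd p \<in> A" "snd p = fst p \<otimes> s"
      "fst p = snd p \<otimes> inv s"
      using p c by (auto simp: inv_solve_left' m_assoc)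
  qed
  \<comment> \<open>Either coordinate of a representation of \<open>s\<close> determines the other.
    The injections out of \<open>V1\<close> and \<open>V2\<close> rest on this.\<close>
  have R_eq: "p = q" if "p \<in> R s" "q \<in> R s" "fst p = fst q \<or> snd p = snd q" for p q s
    using R_fst(5,6)[OF that(1)] R_fst(5,6)[OF that(2)] that(3) by (metis prod_eq_iff)
  have R_card: "t \<le> real (card (R s))" if "s \<in> S" for s
    using S(2)[OF that] by (simp add: quot_reps_def R_def)
  have "S \<subseteq> (\<lambda>(a,b). inv a \<otimes> b) ` (A \<times> A)"
  proof
    fix s assume "s \<in> S"
    then have "0 < card (R s)" using R_card[of s] t by linarith
    then have "R s \<noteq> {}" by auto
    then show "s \<in> (\<lambda>(a,b). inv a \<otimes> b) ` (A \<times> A)" by (auto simp: R_def)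
  qed
  then show finS: "finite S" by (rule finite_subset) (use A in auto)
  have fin3: "finite (S <#> S <#> S)"
    using finS by (simp add: set_mult_def)
  \<comment> \<open>One factorisation of each product is fixed, so that equal products come with the
    same three sets \<open>R\<close>.\<close>
  have "\<exists>p. z = fst p \<otimes> fst (snd p) \<otimes> snd (snd p) \<and> fst p \<in> S \<and> fst (snd p) \<in> S \<and> snd (snd p) \<in> S"
    if "z \<in> S <#> S <#> S" for z
    using that by (fastforce simp: set_mult_def)
  then obtain \<sigma> where \<sigma>: "\<And>z. z \<in> S <#> S <#> S \<Longrightarrow>
     z = fst (\<sigma> z) \<otimes> fst (snd (\<sigma> z)) \<otimes> snd (snd (\<sigma> z)) \<and> fst (\<sigma> z) \<in> S \<and> fst (snd (\<sigma> z)) \<in> S \<and> snd (snd (\<sigma> z)) \<in> S"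
    by metis
  \<comment> \<open>A product \<open>s\<^sub>1s\<^sub>2s\<^sub>3 = a\<^sub>1\<inverse>(b\<^sub>1a\<^sub>2\<inverse>)(b\<^sub>2a\<^sub>3\<inverse>)b\<^sub>3\<close> has at least \<open>t\<^sup>3/2\<close> such expressions
    whose two middle factors lie in \<open>Q\<close>.\<close>
  define U where "U s1 s2 s3 = {p \<in> R s1 \<times> R s2 \<times> R s3.
     (snd (fst p), fst (fst (snd p))) \<notin> bad \<and> (snd (fst (snd p)), fst (snd (snd p))) \<notin> bad}" for s1 s2 s3
  have finbad: "finite bad" using bad A(2) finite_subset by blast
  have U_card: "t ^ 3 / 2 \<le> real (card (U s1 s2 s3))" if s: "s1 \<in> S" "s2 \<in> S" "s3 \<in> S" for s1 s2 s3
  proof -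
    define V1 where "V1 = {p \<in> R s1 \<times> R s2 \<times> R s3. (snd (fst p), fst (fst (snd p))) \<in> bad}"
    define V2 where "V2 = {p \<in> R s1 \<times> R s2 \<times> R s3. (snd (fst (snd p)), fst (snd (snd p))) \<in> bad}"
    \<comment> \<open>The bad pair consists of the second coordinate of the first representation and
      the first coordinate of the second, so it determines both; only the third stays free.
      \<open>V2\<close> is the mirror case.\<close>
    have c1: "card V1 \<le> card (bad \<times> R s3)"
    proof (rule card_inj_on_le)
      show "inj_on (\<lambda>p. ((snd (fst p), fst (fst (snd p))), snd (snd p))) V1"
        proof (rule inj_onI, goal_cases)
        case (1 p q)
        then show "p = q"
          using R_eq[of "fst p" s1 "fst q"] R_eq[of "fst (snd p)" s2 "fst (snd q)"] by (auto simp: V1_def prod_eq_iff)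
      qed
      show "(\<lambda>p. ((snd (fst p), fst (fst (snd p))), snd (snd p))) ` V1 \<subseteq> bad \<times> R s3"
        by (auto simp: V1_def)
      show "finite (bad \<times> R s3)" using finbad R_fin by auto
    qed
    have c2: "card V2 \<le> card (R s1 \<times> bad)"
    proof (rule card_inj_on_le)
      show "inj_on (\<lambda>p. (fst p, (snd (fst (snd p)), fst (snd (snd p))))) V2"
        proof (rule inj_onI, goal_cases)
        case (1 p q)
        then show "p = q"
          using R_eq[of "fst (snd p)" s2 "fst (snd q)"] R_eq[of "snd (snd p)" s3 "snd (snd q)"] by (auto simp: V2_def prod_eq_iff)
      qed
      show "(\<lambda>p. (fst p, (snd (fst (snd p)), fst (snd (snd p))))) ` V2 \<subseteq> R s1 \<times> bad"
        by (auto simp: V2_def)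
      show "finite (R s1 \<times> bad)" using finbad R_fin by auto
    qed
    have "R s1 \<times> R s2 \<times> R s3 = U s1 s2 s3 \<union> (V1 \<union> V2)"
      by (auto simp: U_def V1_def V2_def)
    then have "card (R s1 \<times> R s2 \<times> R s3) \<le> card (U s1 s2 s3) + (card V1 + card V2)"
      by (metis card_Un_le add_left_mono order_trans)
    then have "card (R s1) * (card (R s2) * card (R s3)) \<le> card (U s1 s2 s3) + (card bad * card (R s3) + card (R s1) * card bad)"
      using c1 c2 by (simp add: card_cartesian_product)
    then have *: "real (card (R s1)) * (real (card (R s2)) * real (card (R s3)))
      \<le> real (card (U s1 s2 s3)) + (real (card bad) * real (card (R s3)) + real (card (R s1)) * real (card bad))"
      by (metis of_nat_add of_nat_mult of_nat_mono)
    define x y z where "x = real (card (R s1))" and "y = real (card (R s2))" and "z = real (card (R s3))"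
    have xyz: "t \<le> x" "t \<le> y" "t \<le> z" using R_card s by (auto simp: x_def y_def z_def)
    \<comment> \<open>As |bad| is at most t^2/4, hence at most xy/4 and yz/4, \<open>V1\<close> and
      \<open>V2\<close> each remove at most a quarter of the xyz triples.\<close>
    have xy: "t\<^sup>2 \<le> x * y" and yz: "t\<^sup>2 \<le> y * z"
      using xyz t by (auto simp: power2_eq_square intro!: mult_mono)
    have "real (card bad) * z \<le> (x * y / 4) * z" "x * real (card bad) \<le> x * (y * z / 4)"
      using xy yz t xyz by (auto intro!: mult_mono)
    then have "x * (y * z) / 2 \<le> real (card (U s1 s2 s3))"
      using * unfolding x_def[symmetric] y_def[symmetric] z_def[symmetric] by (simp add: field_simps)
    moreover have "t ^ 3 \<le> x * (y * z)" using xyz t by (auto simp: power3_eq_cube mult.assoc intro!: mult_mono)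
    ultimately show ?thesis by linarith
  qed
  define F where "F z = U (fst (\<sigma> z)) (fst (snd (\<sigma> z))) (snd (snd (\<sigma> z)))" for z
  have finU: "finite (U s1 s2 s3)" for s1 s2 s3
    by (rule finite_subset[of _ "R s1 \<times> R s2 \<times> R s3"]) (auto simp: U_def R_fin)
  have "real (card (S <#> S <#> S)) * (t ^ 3 / 2) \<le> (\<Sum>z\<in>S <#> S <#> S. real (card (F z)))"
    unfolding F_def by (rule sum_bounded_below) (use \<sigma> U_card in auto)
  also have "\<dots> = real (card (Sigma (S <#> S <#> S) F))"
    using fin3 finU by (subst card_SigmaI) (auto simp: F_def)
  also have "card (Sigma (S <#> S <#> S) F) \<le> card (A \<times> Q \<times> Q \<times> A)"
  proof (rule card_inj_on_le)
    let ?f = "\<lambda>(z, p1, p2, p3). (fst p1, snd p1 \<otimes> inv (fst p2), snd p2 \<otimes> inv (fst p3), snd p3)"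
    show "?f ` Sigma (S <#> S <#> S) F \<subseteq> A \<times> Q \<times> Q \<times> A"
    proof (rule image_subsetI)
      fix u assume "u \<in> Sigma (S <#> S <#> S) F"
      moreover obtain z p1 p2 p3 where u: "u = (z, p1, p2, p3)" by (cases u) auto
      ultimately have U: "(p1, p2, p3) \<in> U (fst (\<sigma> z)) (fst (snd (\<sigma> z))) (snd (snd (\<sigma> z)))"
        by (simp add: F_def)
      then have "fst p1 \<in> A" "snd p1 \<in> A" "fst p2 \<in> A" "snd p2 \<in> A" "fst p3 \<in> A" "snd p3 \<in> A"
        unfolding U_def mem_Collect_eq mem_Sigma_iff using R_fst(3,4) by blast+
      then show "?f u \<in> A \<times> Q \<times> Q \<times> A"
        using U good by (simp add: u U_def)
    qed
    show "finite (A \<times> Q \<times> Q \<times> A)" using A Q by auto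
    show "inj_on ?f (Sigma (S <#> S <#> S) F)"
    proof (rule inj_onI)
      fix u v assume uv: "u \<in> Sigma (S <#> S <#> S) F" "v \<in> Sigma (S <#> S <#> S) F" and e: "?f u = ?f v"
      obtain z p1 p2 p3 where u: "u = (z, p1, p2, p3)" by (cases u) auto
      obtain z' q1 q2 q3 where v: "v = (z', q1, q2, q3)" by (cases v) auto
      \<comment> \<open>The four coordinates of the image, the first one inverted, multiply to
        \<open>z\<close>. After that each outer representation is recovered from one coordinate and
        the middle one by cancellation.\<close>
      have key: "z = inv (fst p1) \<otimes> (snd p1 \<otimes> inv (fst p2)) \<otimes> (snd p2 \<otimes> inv (fst p3)) \<otimes> snd p3"
        if pF: "(z, p1, p2, p3) \<in> Sigma (S <#> S <#> S) F" for z p1 p2 p3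
      proof -
        have zS: "z \<in> S <#> S <#> S" and pU: "(p1, p2, p3) \<in> U (fst (\<sigma> z)) (fst (snd (\<sigma> z))) (snd (snd (\<sigma> z)))"
          using pF by (simp_all add: F_def)
        obtain s1 s2 s3 where s: "s1 \<in> S" "s2 \<in> S" "s3 \<in> S" "z = s1 \<otimes> s2 \<otimes> s3"
          "p1 \<in> R s1" "p2 \<in> R s2" "p3 \<in> R s3"
          using \<sigma>[OF zS] pU unfolding U_def mem_Collect_eq mem_Sigma_iff by blast
        have i: "inv (fst p) \<otimes> snd p = s" if "p \<in> R s" for p s using that by (auto simp: R_def)
        have "z = (inv (fst p1) \<otimes> snd p1) \<otimes> (inv (fst p2) \<otimes> snd p2) \<otimes> (inv (fst p3) \<otimes> snd p3)"
          using s(4) i[OF s(5)] i[OF s(6)] i[OF s(7)] by simp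
        then show ?thesis using s R_fst(1,2)[OF s(5)] R_fst(1,2)[OF s(6)] R_fst(1,2)[OF s(7)]
          by (simp add: m_assoc)
      qed
      have zz: "z = z'"
        using key[of z p1 p2 p3] key[of z' q1 q2 q3] uv e unfolding u v by simp
      obtain s1 s2 s3 where s:
          "p1 \<in> R s1" "p2 \<in> R s2" "p3 \<in> R s3" "q1 \<in> R s1" "q2 \<in> R s2" "q3 \<in> R s3"
        using uv by (auto simp: u v F_def U_def zz)
      have e1: "p1 = q1" using e R_fst(5)[OF s(1)] R_fst(5)[OF s(4)] by (auto simp: u v prod_eq_iff)
      have e3: "p3 = q3" using e R_fst(6)[OF s(3)] R_fst(6)[OF s(6)] by (auto simp: u v prod_eq_iff)
      have "snd q1 \<otimes> inv (fst p2) = snd q1 \<otimes> inv (fst q2)" using e by (auto simp: u v e1)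
      then have "fst p2 = fst q2"
        using R_fst(1,2)[OF s(4)] R_fst(1,2)[OF s(2)] R_fst(1,2)[OF s(5)] by (metis Units_eq Units_l_cancel inv_inv inv_closed)
      then have e2: "p2 = q2" using R_fst(5)[OF s(2)] R_fst(5)[OF s(5)] by (auto simp: prod_eq_iff)
      show "u = v" by (simp add: u v zz e1 e2 e3)
    qed
  qed
  finally show "real (card (S <#> S <#> S)) * (t ^ 3 / 2) \<le> (real (card A))\<^sup>2 * (real (card Q))\<^sup>2"
    by (simp add: card_cartesian_product power2_eq_square ac_simps)
qed

text \<open>Dependent random choice. Vertices of low degree are discarded first. Cauchy-Schwarz
  bounds the mean square size of a neighbourhood from below, while a pair with few common neighbours
  lies in few neighbourhoods. The size bound stays squared to avoid a square root.\<close>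

lemma dense_neighbourhood:
  fixes \<delta> \<epsilon> :: real
  assumes fin: "finite U" "finite W" and ne: "W \<noteq> {}" and E: "E \<subseteq> U \<times> W"
    and \<delta>: "0 < \<delta>" and \<epsilon>: "0 < \<epsilon>" and dense: "\<delta> * real (card U) * real (card W) \<le> real (card E)"
  obtains A where "A \<subseteq> U" "\<And>u. u \<in> A \<Longrightarrow> \<delta> * real (card W) / 2 \<le> real (card {w. (u, w) \<in> E})"
    "\<delta>\<^sup>2 * (real (card U))\<^sup>2 / 8 \<le> (real (card A))\<^sup>2"
    "real (card {(u, v) \<in> A \<times> A. real (card {w. (u, w) \<in> E \<and> (v, w) \<in> E}) < \<epsilon> * \<delta>\<^sup>2 / 8 * real (card W)})
      \<le> \<epsilon> * (real (card U))\<^sup>2"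
proof -
  define deg where "deg u = card {w. (u, w) \<in> E}" for u
  define V where "V = {u \<in> U. \<delta> * real (card W) / 2 \<le> real (deg u)}"
  define N where "N w = {u \<in> V. (u, w) \<in> E}" for w
  \<comment> \<open>The threshold makes the bad pairs, weighted by \<open>1 / \<epsilon>\<close>,
    cost at most half of the second moment bound \<open>N2\<close>; see \<open>B2\<close>.\<close>
  define Bad where "Bad = {(u, v) \<in> U \<times> U. real (card {w. (u, w) \<in> E \<and> (v, w) \<in> E}) < \<epsilon> * \<delta>\<^sup>2 / 8 * real (card W)}"
  define n where "n = real (card U)"
  define m where "m = real (card W)"
  have m: "m > 0" using fin ne by (simp add: m_def card_gt_0_iff)
  have finV: "finite V" and VU: "V \<subseteq> U" using fin by (auto simp: V_def)
  have Esec: "finite {w. (u, w) \<in> E}" for u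
    by (rule finite_subset[OF _ fin(2)]) (use E in auto)
  have "card E = card (Sigma U (\<lambda>u. {w. (u, w) \<in> E}))"
    by (rule arg_cong[where f=card]) (use E in auto)
  also have "\<dots> = (\<Sum>u\<in>U. deg u)" using fin Esec by (simp add: card_SigmaI deg_def)
  finally have "real (card E) = (\<Sum>u\<in>U. real (deg u))" by simp
  also have "\<dots> = (\<Sum>u\<in>V. real (deg u)) + (\<Sum>u\<in>U - V. real (deg u))"
    using fin VU by (simp add: sum.subset_diff[of V U])
  also have "(\<Sum>u\<in>U - V. real (deg u)) \<le> real (card (U - V)) * (\<delta> * m / 2)"
    by (rule sum_bounded_above) (auto simp: V_def m_def)
  also have "\<dots> \<le> n * (\<delta> * m / 2)"
    using \<delta> m fin by (intro mult_right_mono) (auto simp: n_def intro!: card_mono)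
  finally have dV: "\<delta> * n * m / 2 \<le> (\<Sum>u\<in>V. real (deg u))"
    using dense by (simp add: n_def m_def field_simps)
  have "(\<Sum>w\<in>W. card (N w)) = card (SIGMA w:W. N w)"
    using fin finV by (simp add: N_def)
  also have "\<dots> = card (SIGMA u:V. {w. (u, w) \<in> E})"
    by (rule bij_betw_same_card[of prod.swap])
      (auto simp: bij_betw_def inj_on_def N_def image_iff Bex_def dest: subsetD[OF E])
  also have "\<dots> = (\<Sum>u\<in>V. deg u)"
    using finV Esec by (simp add: deg_def)
  finally have NV: "(\<Sum>w\<in>W. real (card (N w))) = (\<Sum>u\<in>V. real (deg u))"
    by (metis of_nat_sum)
  have "(\<delta> * n * m / 2)\<^sup>2 \<le> (\<Sum>w\<in>W. real (card (N w)))\<^sup>2"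
    using dV \<delta> m by (intro power_mono) (auto simp: NV n_def)
  also have "\<dots> \<le> m * (\<Sum>w\<in>W. (real (card (N w)))\<^sup>2)"
    unfolding m_def using sum_squared_le_sum_of_squares[of "\<lambda>w. real (card (N w))" W]
    by (simp add: mult.commute)
  finally have N2: "\<delta>\<^sup>2 * n\<^sup>2 * m / 4 \<le> (\<Sum>w\<in>W. (real (card (N w)))\<^sup>2)"
    using m by (simp add: power2_eq_square field_simps)
  have finBad: "finite Bad" by (rule finite_subset[of _ "U \<times> U"]) (use fin in \<open>auto simp: Bad_def\<close>)
  have "(\<Sum>w\<in>W. card (Bad \<inter> N w \<times> N w)) = card (SIGMA w:W. Bad \<inter> N w \<times> N w)"
    using fin finBad by simp
  also have "\<dots> \<le> card (SIGMA p:Bad. {w. (fst p, w) \<in> E \<and> (snd p, w) \<in> E})"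
  proof (rule card_inj_on_le[of prod.swap])
    show "finite (SIGMA p:Bad. {w. (fst p, w) \<in> E \<and> (snd p, w) \<in> E})"
      using finBad Esec by (auto simp: intro!: finite_SigmaI)
  qed (auto simp: inj_on_def N_def)
  also have "\<dots> = (\<Sum>p\<in>Bad. card {w. (fst p, w) \<in> E \<and> (snd p, w) \<in> E})"
    using finBad Esec by simp
  finally have "(\<Sum>w\<in>W. real (card (Bad \<inter> N w \<times> N w))) \<le> (\<Sum>p\<in>Bad. real (card {w. (fst p, w) \<in> E \<and> (snd p, w) \<in> E}))"
    unfolding of_nat_sum[symmetric] of_nat_le_iff .
  also have "\<dots> \<le> real (card Bad) * (\<epsilon> * \<delta>\<^sup>2 / 8 * m)"
    by (rule sum_bounded_above) (auto simp: Bad_def m_def)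
  also have "\<dots> \<le> n\<^sup>2 * (\<epsilon> * \<delta>\<^sup>2 / 8 * m)"
  proof (rule mult_right_mono)
    have "card Bad \<le> card (U \<times> U)" by (rule card_mono) (use fin in \<open>auto simp: Bad_def\<close>)
    then show "real (card Bad) \<le> n\<^sup>2"
      by (simp add: n_def power2_eq_square card_cartesian_product flip: of_nat_mult)
  qed (use \<epsilon> m in auto)
  finally have B2: "(\<Sum>w\<in>W. real (card (Bad \<inter> N w \<times> N w)) / \<epsilon>) \<le> \<delta>\<^sup>2 * n\<^sup>2 * m / 8"
    using \<epsilon> by (simp add: field_simps flip: sum_divide_distrib)
  \<comment> \<open>The neighbourhood of a uniformly random \<open>w\<close> has the required properties in expectation.\<close>
  have "\<exists>w\<in>W. \<delta>\<^sup>2 * n\<^sup>2 / 8 + real (card (Bad \<inter> N w \<times> N w)) / \<epsilon> \<le> (real (card (N w)))\<^sup>2"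
  proof (rule ccontr)
    assume "\<not> ?thesis"
    then have "(\<Sum>w\<in>W. (real (card (N w)))\<^sup>2) < (\<Sum>w\<in>W. \<delta>\<^sup>2 * n\<^sup>2 / 8 + real (card (Bad \<inter> N w \<times> N w)) / \<epsilon>)"
      using fin ne by (intro sum_strict_mono) (auto simp: not_le)
    also have "\<dots> = \<delta>\<^sup>2 * n\<^sup>2 * m / 8 + (\<Sum>w\<in>W. real (card (Bad \<inter> N w \<times> N w)) / \<epsilon>)"
      by (simp add: sum.distrib m_def)
    also have "\<dots> \<le> \<delta>\<^sup>2 * n\<^sup>2 * m / 4"
      using B2 by linarith
    finally show False using N2 by simp
  qed
  then obtain w where w: "\<delta>\<^sup>2 * n\<^sup>2 / 8 + real (card (Bad \<inter> N w \<times> N w)) / \<epsilon> \<le> (real (card (N w)))\<^sup>2" by blast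
  show ?thesis
  proof
    show "N w \<subseteq> U" using VU by (auto simp: N_def)
    show "\<delta> * real (card W) / 2 \<le> real (card {w. (u, w) \<in> E})" if "u \<in> N w" for u
      using that by (auto simp: N_def V_def deg_def)
    show "\<delta>\<^sup>2 * (real (card U))\<^sup>2 / 8 \<le> (real (card (N w)))\<^sup>2"
      using w \<epsilon> order_trans[OF _ w, of "\<delta>\<^sup>2 * (real (card U))\<^sup>2 / 8"] unfolding n_def by auto
    have "{(u, v) \<in> N w \<times> N w. real (card {w. (u, w) \<in> E \<and> (v, w) \<in> E}) < \<epsilon> * \<delta>\<^sup>2 / 8 * real (card W)} = Bad \<inter> N w \<times> N w"
      using VU by (auto simp: Bad_def N_def)
    moreover have "real (card (Bad \<inter> N w \<times> N w)) \<le> \<epsilon> * (real (card U))\<^sup>2"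
    proof -
      have "real (card (Bad \<inter> N w \<times> N w)) / \<epsilon> \<le> (real (card (N w)))\<^sup>2"
        using w by (smt (verit) divide_nonneg_pos zero_le_power2 mult_nonneg_nonneg)
      also have "\<dots> \<le> (real (card U))\<^sup>2"
        using fin VU by (intro power_mono) (auto simp: N_def intro!: card_mono)
      finally show ?thesis using \<epsilon> by (simp add: field_simps)
    qed
    ultimately show "real (card {(u, v) \<in> N w \<times> N w. real (card {w. (u, w) \<in> E \<and> (v, w) \<in> E}) < \<epsilon> * \<delta>\<^sup>2 / 8 * real (card W)})
      \<le> \<epsilon> * (real (card U))\<^sup>2" by simp
  qed
qed

lemma sum_card_fibres_le:
  assumes "finite S" "finite Q"
  shows "(\<Sum>x\<in>Q. card {z \<in> S. g z = x}) \<le> card S"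
proof -
  have "(\<Sum>x\<in>Q. card {z \<in> S. g z = x}) = card (\<Union>x\<in>Q. {z \<in> S. g z = x})"
    by (rule card_UN_disjoint[symmetric]) (use assms in auto)
  also have "\<dots> \<le> card S" by (rule card_mono) (use assms in auto)
  finally show ?thesis .
qed

text \<open>Instead of passing through sets with small quotient, we use that almost all \<open>(u, v) \<in> A \<times> A\<close> have
  \<open>uv\<inverse>\<close> in a small set \<open>Q\<close>. The popularity threshold \<open>t\<close> comes from the energy between \<open>A\<close> and \<open>D\<close> and
  hence does not depend on \<open>\<epsilon>\<close>, so that \<open>\<epsilon>\<close> may be chosen small in terms of \<open>t\<close>.\<close>

lemma (in group) balog_szemeredi_gowers:
  fixes \<delta> M :: real
  assumes D: "D \<subseteq> carrier G" "finite D" "D \<noteq> {}" and P: "P \<subseteq> carrier G" "finite P"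
    and \<delta>: "0 < \<delta>" and M: "0 < M"
    and dense: "\<delta> * real (card D) * real (card D) \<le> real (card {(a, b) \<in> D \<times> D. a \<otimes> b \<in> P})"
    and small: "real (card P) \<le> M * real (card D)"
  obtains c A S where "c \<in> D" "A \<subseteq> D" "\<delta> ^ 3 / (24 * M) * real (card D) \<le> real (card A)"
    "S \<subseteq> carrier G" "finite S" "\<And>s. s \<in> S \<Longrightarrow> inv s \<in> S" "inv c <# A \<subseteq> S"
    "real (card (S <#> S <#> S)) \<le> 2 ^ 53 * M ^ 11 / \<delta> ^ 32 * real (card D)"
proof -
  define n where "n = real (card D)"
  have n: "n > 0" using D by (simp add: n_def card_gt_0_iff)
  \<comment> \<open>Fixed by \<open>\<epsilon> * n\<^sup>2 = t\<^sup>2 / 4\<close> with the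
    popularity threshold \<open>t\<close> below: this is the bound on \<open>bad\<close> that the
    tripling lemma asks for.\<close>
  define \<epsilon> where "\<epsilon> = \<delta> ^ 8 / (2 ^ 14 * M\<^sup>2)"
  define E where "E = {(a, b) \<in> D \<times> D. a \<otimes> b \<in> P}"
  have \<epsilon>: "\<epsilon> > 0" using \<delta> M by (simp add: \<epsilon>_def)
  define h where "h = \<epsilon> * \<delta>\<^sup>2 / 8 * n"
  have h: "h > 0" using \<epsilon> \<delta> n by (simp add: h_def)
  obtain A where A: "A \<subseteq> D" "\<And>u. u \<in> A \<Longrightarrow> \<delta> * n / 2 \<le> real (card {w. (u, w) \<in> E})"
    "\<delta>\<^sup>2 * n\<^sup>2 / 8 \<le> (real (card A))\<^sup>2"
    "real (card {(u, v) \<in> A \<times> A. real (card {w. (u, w) \<in> E \<and> (v, w) \<in> E}) < h}) \<le> \<epsilon> * n\<^sup>2"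
    using dense_neighbourhood[of D D E \<delta> \<epsilon>] D \<delta> \<epsilon> dense unfolding E_def n_def h_def by blast
  define m where "m = real (card A)"
  have AG: "A \<subseteq> carrier G" and finA: "finite A" using A(1) D finite_subset[OF A(1) D(2)] by auto
  have Ac: "a \<in> carrier G" if "a \<in> A" for a using that AG by auto
  have Dc: "a \<in> carrier G" if "a \<in> D" for a using that D by auto
  \<comment> \<open>The constant 1/3 replaces 1/sqrt 8, using 1/9 <= 1/8.\<close>
  have m9: "(\<delta> * n / 3)\<^sup>2 \<le> m\<^sup>2"
    using A(3) \<delta> n by (simp add: m_def power_mult_distrib power_divide) (smt (verit) zero_le_power2 mult_nonneg_nonneg)
  have mlow: "\<delta> * n / 3 \<le> m" by (rule power2_le_imp_le[OF m9]) (simp add: m_def)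
  have m: "m > 0" using mlow \<delta> n by (smt (verit) divide_pos_pos mult_pos_pos)
  have mn: "m \<le> n" using A(1) D by (auto simp: m_def n_def intro!: card_mono)
  \<comment> \<open>Small enough that n t is at most half of m^2 \<delta>^2/(4M), by the bound m^2
    >= \<delta>^2 n^2/8; unpopular quotients then account for at most half of the energy
    bound.\<close>
  define t where "t = \<delta> ^ 4 * n / (64 * M)"
  have t: "t > 0" using \<delta> n M by (simp add: t_def)
  have t2: "\<epsilon> * n\<^sup>2 = t\<^sup>2 / 4" using M by (simp add: \<epsilon>_def t_def field_simps power2_eq_square flip: power_add)
  define bad where "bad = {(u, v) \<in> A \<times> A. real (card {w. (u, w) \<in> E \<and> (v, w) \<in> E}) < h}"
  define pq where "pq = (\<lambda>(p, q). p \<otimes> inv q)"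
  \<comment> \<open>Every element of \<open>Q\<close> uses up \<open>h\<close> pairs from
    \<open>P\<close>, so |Q| is at most |P|^2/h. A good pair (u, v) has at least \<open>h\<close>
    common neighbours w, and each of them writes u v^-1 as (uw)(vw)^-1 with uw and vw in
    \<open>P\<close>.\<close>
  define Q where "Q = {x \<in> pq ` (P \<times> P). h \<le> real (card {z \<in> P \<times> P. pq z = x})}"
  have finQ: "finite Q" using P by (simp add: Q_def)
  have "real (card Q) * h \<le> (\<Sum>x\<in>Q. real (card {z \<in> P \<times> P. pq z = x}))"
    by (rule sum_bounded_below) (auto simp: Q_def)
  also have "\<dots> \<le> real (card (P \<times> P))"
    unfolding of_nat_sum[symmetric] of_nat_le_iff by (rule sum_card_fibres_le) (use P finQ in auto)
  also have "\<dots> \<le> (M * n) * (M * n)"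
    using small by (auto simp: card_cartesian_product n_def intro!: mult_mono)
  finally have Qh: "real (card Q) \<le> M\<^sup>2 * n\<^sup>2 / h" using h by (simp add: field_simps power2_eq_square)
  have good: "u \<otimes> inv v \<in> Q" if uv: "u \<in> A" "v \<in> A" "(u, v) \<notin> bad" for u v
  proof -
    let ?W = "{w. (u, w) \<in> E \<and> (v, w) \<in> E}"
    have W: "h \<le> real (card ?W)" using uv by (auto simp: bad_def)
    have "card ?W \<le> card {z \<in> P \<times> P. pq z = u \<otimes> inv v}"
    proof (rule card_inj_on_le[of "\<lambda>w. (u \<otimes> w, v \<otimes> w)"])
      show "inj_on (\<lambda>w. (u \<otimes> w, v \<otimes> w)) ?W"
        using uv by (auto simp: inj_on_def E_def Ac Dc)
      show "(\<lambda>w. (u \<otimes> w, v \<otimes> w)) ` ?W \<subseteq> {z \<in> P \<times> P. pq z = u \<otimes> inv v}"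
        using uv by (auto simp: E_def pq_def Ac Dc inv_mult_group m_assoc)
          (metis Ac Dc inv_closed inv_solve_left' m_closed)
    qed (use P in auto)
    then have W': "h \<le> real (card {z \<in> P \<times> P. pq z = u \<otimes> inv v})" using W by linarith
    then have "{z \<in> P \<times> P. pq z = u \<otimes> inv v} \<noteq> {}" using h by (smt (verit) card.empty of_nat_0)
    then obtain z where "z \<in> P \<times> P" "pq z = u \<otimes> inv v" by blast
    then have "u \<otimes> inv v \<in> pq ` (P \<times> P)" by (metis image_eqI)
    then show ?thesis using W' by (simp add: Q_def)
  qed
  define S where "S = {s \<in> carrier G. t \<le> real (quot_reps G A s)}"
  have cb: "real (card bad) \<le> t\<^sup>2 / 4" using A(4) by (simp add: t2 bad_def)
  note tri = popular_quotients_tripling[of A Q bad t S, OF AG finA finQ _ good t cb]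
  have bad_sub: "bad \<subseteq> A \<times> A" by (auto simp: bad_def)
  have finS: "finite S" by (rule tri(2)) (use bad_sub in \<open>auto simp: S_def\<close>)
  have "real (card (S <#> S <#> S)) * (t ^ 3 / 2) \<le> m\<^sup>2 * (real (card Q))\<^sup>2"
    unfolding m_def by (rule tri(1)) (use bad_sub in \<open>auto simp: S_def\<close>)
  also have "\<dots> \<le> n\<^sup>2 * (M\<^sup>2 * n\<^sup>2 / h)\<^sup>2"
    using mn m Qh by (intro mult_mono power_mono) auto
  also have "\<dots> = (2 ^ 53 * M ^ 11 / \<delta> ^ 32 * n) * (t ^ 3 / 2)"
    using \<delta> M n unfolding h_def t_def \<epsilon>_def by (simp add: field_simps eval_nat_numeral)
  finally have SSS: "real (card (S <#> S <#> S)) \<le> 2 ^ 53 * M ^ 11 / \<delta> ^ 32 * n"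
    by (rule mult_right_le_imp_le) (use t in simp)
  define fib where "fib p = {z \<in> A \<times> D. fst z \<otimes> snd z = p}" for p
  have finfib: "finite (fib p)" for p using finA D by (auto simp: fib_def)
  \<comment> \<open>The solutions of ab = a'b', that is, the energy between \<open>A\<close> and
    \<open>D\<close>. Elements of \<open>A\<close> have large degree, so Cauchy-Schwarz over the few
    products in \<open>P\<close> bounds it from below.\<close>
  define Quad where "Quad = {z \<in> (A \<times> D) \<times> (A \<times> D). fst (fst z) \<otimes> snd (fst z) = fst (snd z) \<otimes> snd (snd z)}"
  have finQuad: "finite Quad" using finA D by (auto simp: Quad_def)
  have "m * (\<delta> * n / 2) \<le> (\<Sum>a\<in>A. real (card {b. (a, b) \<in> E}))"
    unfolding m_def by (rule sum_bounded_below) (use A(2) in auto)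
  also have "\<dots> = real (card (SIGMA a:A. {b. (a, b) \<in> E}))"
    using finA by (subst card_SigmaI) (auto simp: E_def intro!: finite_subset[OF _ D(2)])
  also have "(SIGMA a:A. {b. (a, b) \<in> E}) = (\<Union>p\<in>P. fib p)"
    using A(1) by (auto simp: E_def fib_def)
  also have "card (\<Union>p\<in>P. fib p) = (\<Sum>p\<in>P. card (fib p))"
    by (rule card_UN_disjoint) (use P finfib in \<open>auto simp: fib_def\<close>)
  finally have "m * (\<delta> * n / 2) \<le> (\<Sum>p\<in>P. real (card (fib p)))" by simp
  then have "(m * (\<delta> * n / 2))\<^sup>2 \<le> (\<Sum>p\<in>P. real (card (fib p)))\<^sup>2"
    using m \<delta> n by (intro power_mono) auto
  also have "\<dots> \<le> (\<Sum>p\<in>P. (real (card (fib p)))\<^sup>2) * real (card P)"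
    by (rule sum_squared_le_sum_of_squares)
  also have "\<dots> \<le> (\<Sum>p\<in>P. (real (card (fib p)))\<^sup>2) * (M * n)"
    using small by (intro mult_left_mono sum_nonneg) (auto simp: n_def)
  finally have "m\<^sup>2 * \<delta>\<^sup>2 * n / (4 * M) \<le> (\<Sum>p\<in>P. (real (card (fib p)))\<^sup>2)"
    using n M by (simp add: field_simps power2_eq_square)
  also have "\<dots> = real (\<Sum>p\<in>P. card (fib p \<times> fib p))"
    by (simp add: card_cartesian_product power2_eq_square)
  also have "(\<Sum>p\<in>P. card (fib p \<times> fib p)) = card (\<Union>p\<in>P. fib p \<times> fib p)"
    by (rule card_UN_disjoint[symmetric]) (use P finfib in \<open>auto simp: fib_def\<close>)
  also have "\<dots> \<le> card Quad"
    by (rule card_mono[OF finQuad]) (auto simp: fib_def Quad_def)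
  finally have Q1: "m\<^sup>2 * \<delta>\<^sup>2 * n / (4 * M) \<le> real (card Quad)" by simp
  define Pop where "Pop = {(c, a) \<in> A \<times> A. inv c \<otimes> a \<in> S}"
  have finPop: "finite Pop" by (rule finite_subset[of _ "A \<times> A"]) (use finA in \<open>auto simp: Pop_def\<close>)
  \<comment> \<open>Solutions are split by whether a^-1 a' is popular. For fixed (b, b') this
    quotient always equals b b'^-1, so an unpopular one leaves at most \<open>t\<close> choices of
    (a, a'); the popular solutions are charged to \<open>Pop\<close>.\<close>
  define Q1 where "Q1 = {z \<in> Quad. (fst (fst z), fst (snd z)) \<in> Pop}"
  define Q2 where "Q2 = {z \<in> Quad. (fst (fst z), fst (snd z)) \<notin> Pop}"
  have "card Q1 \<le> card (Pop \<times> D)"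
  proof (rule card_inj_on_le[of "\<lambda>z. ((fst (fst z), fst (snd z)), snd (fst z))"])
    show "inj_on (\<lambda>z. ((fst (fst z), fst (snd z)), snd (fst z))) Q1"
      by (rule inj_onI) (auto simp: Q1_def Quad_def Ac Dc)
    show "(\<lambda>z. ((fst (fst z), fst (snd z)), snd (fst z))) ` Q1 \<subseteq> Pop \<times> D"
      by (auto simp: Q1_def Quad_def)
  qed (use finPop D in auto)
  then have cQ1: "real (card Q1) \<le> real (card Pop) * n"
    by (simp add: card_cartesian_product n_def flip: of_nat_mult)
  have "card Q2 = (\<Sum>x\<in>D \<times> D. card {z \<in> Q2. (snd (fst z), snd (snd z)) = x})"
  proof -
    have "Q2 = (\<Union>x\<in>D \<times> D. {z \<in> Q2. (snd (fst z), snd (snd z)) = x})"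
      by (auto simp: Q2_def Quad_def)
    moreover have "card \<dots> = (\<Sum>x\<in>D \<times> D. card {z \<in> Q2. (snd (fst z), snd (snd z)) = x})"
      by (rule card_UN_disjoint) (use D finQuad in \<open>auto simp: Q2_def\<close>)
    ultimately show ?thesis by simp
  qed
  then have "real (card Q2) = (\<Sum>x\<in>D \<times> D. real (card {z \<in> Q2. (snd (fst z), snd (snd z)) = x}))" by simp
  also have "\<dots> \<le> real (card (D \<times> D)) * t"
  proof (rule sum_bounded_above)
    fix x assume x: "x \<in> D \<times> D"
    let ?F = "{z \<in> Q2. (snd (fst z), snd (snd z)) = x}"
    obtain b b' where b: "x = (b, b')" "b \<in> D" "b' \<in> D" using x by auto
    have q: "inv (fst (fst z)) \<otimes> fst (snd z) = b \<otimes> inv b'" if "z \<in> ?F" for z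
    proof -
      have "fst (fst z) \<in> carrier G" "fst (snd z) \<in> carrier G" "b \<in> carrier G" "b' \<in> carrier G"
        "fst (fst z) \<otimes> b = fst (snd z) \<otimes> b'"
        using that b Ac Dc by (auto simp: Q2_def Quad_def)
      then show ?thesis by (metis inv_closed inv_solve_left inv_solve_right m_assoc m_closed)
    qed
    show "real (card ?F) \<le> t"
    proof (cases "?F = {}")
      case True then show ?thesis using t by (metis card.empty less_imp_le of_nat_0)
    next
      case False
      then obtain z where z: "z \<in> ?F" by auto
      have "b \<otimes> inv b' \<in> carrier G" using b Dc by auto
      then have "b \<otimes> inv b' \<notin> S \<and> b \<otimes> inv b' \<in> carrier G"
        using q[OF z] z by (auto simp: Q2_def Quad_def Pop_def)
      then have "real (quot_reps G A (b \<otimes> inv b')) \<le> t" by (auto simp: S_def)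
      moreover have "card ?F \<le> quot_reps G A (b \<otimes> inv b')"
        unfolding quot_reps_def
      proof (rule card_inj_on_le[of "\<lambda>z. (fst (fst z), fst (snd z))"])
        show "inj_on (\<lambda>z. (fst (fst z), fst (snd z))) ?F"
          by (rule inj_onI) (auto simp: prod_eq_iff)
        show "(\<lambda>z. (fst (fst z), fst (snd z))) ` ?F \<subseteq> {(b1, b2) \<in> A \<times> A. inv b1 \<otimes> b2 = b \<otimes> inv b'}"
          using q by (auto simp: Q2_def Quad_def)
        show "finite {(b1, b2) \<in> A \<times> A. inv b1 \<otimes> b2 = b \<otimes> inv b'}"
          by (rule finite_subset[of _ "A \<times> A"]) (use finA in auto)
      qed
      ultimately show ?thesis by linarith
    qed
  qed
  also have "\<dots> = n * n * t" by (simp add: card_cartesian_product n_def)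
  finally have cQ2: "real (card Q2) \<le> n * n * t" .
  have "Quad = Q1 \<union> Q2" by (auto simp: Q1_def Q2_def)
  then have "card Quad \<le> card Q1 + card Q2" by (simp add: card_Un_le)
  then have "m\<^sup>2 * \<delta>\<^sup>2 * n / (4 * M) \<le> real (card Pop) * n + n * n * t"
    using Q1 cQ1 cQ2 by linarith
  then have "m\<^sup>2 * \<delta>\<^sup>2 / (4 * M) * n \<le> (real (card Pop) + n * t) * n" by (simp add: algebra_simps)
  then have pop0: "m\<^sup>2 * \<delta>\<^sup>2 / (4 * M) \<le> real (card Pop) + n * t" using n by (rule mult_right_le_imp_le)
  have "n * t = \<delta>\<^sup>2 / (8 * M) * (\<delta>\<^sup>2 * n\<^sup>2 / 8)"
    by (simp add: t_def field_simps power2_eq_square eval_nat_numeral)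
  also have "\<dots> \<le> \<delta>\<^sup>2 / (8 * M) * m\<^sup>2" using A(3) M by (intro mult_left_mono) (auto simp: m_def)
  finally have pop: "m * (\<delta>\<^sup>2 / (8 * M) * m) \<le> real (card Pop)"
    using pop0 by (simp add: field_simps power2_eq_square)
  \<comment> \<open>Averaging \<open>Pop\<close> over its first coordinate yields a \<open>c\<close>
    for which many c^-1 a lie in \<open>S\<close>; these elements \<open>a\<close> form the final
    subset.\<close>
  define A' where "A' c = {a \<in> A. inv c \<otimes> a \<in> S}" for c
  have "Pop = Sigma A A'" by (auto simp: Pop_def A'_def)
  then have "card Pop = (\<Sum>c\<in>A. card (A' c))" using finA by (simp add: A'_def)
  then have pop: "m * (\<delta>\<^sup>2 / (8 * M) * m) \<le> (\<Sum>c\<in>A. real (card (A' c)))" using pop by simp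
  have "\<exists>c\<in>A. \<delta>\<^sup>2 / (8 * M) * m \<le> real (card (A' c))"
  proof (rule ccontr)
    assume "\<not> ?thesis"
    then have "(\<Sum>c\<in>A. real (card (A' c))) < (\<Sum>c\<in>A. \<delta>\<^sup>2 / (8 * M) * m)"
      using finA m by (intro sum_strict_mono) (auto simp: not_le m_def)
    then show False using pop by (simp add: m_def)
  qed
  then obtain c where c: "c \<in> A" "\<delta>\<^sup>2 / (8 * M) * m \<le> real (card (A' c))" by blast
  show ?thesis
  proof
    show "c \<in> D" "A' c \<subseteq> D" using c A(1) by (auto simp: A'_def)
    have "\<delta> ^ 3 / (24 * M) * n = \<delta>\<^sup>2 / (8 * M) * (\<delta> * n / 3)" by (simp add: field_simps power2_eq_square eval_nat_numeral)
    also have "\<dots> \<le> \<delta>\<^sup>2 / (8 * M) * m" using mlow M by (intro mult_left_mono) auto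
    finally show "\<delta> ^ 3 / (24 * M) * real (card D) \<le> real (card (A' c))" using c by (simp add: n_def)
    show "S \<subseteq> carrier G" "finite S" using finS by (auto simp: S_def)
    show "inv c <# A' c \<subseteq> S" by (auto simp: A'_def l_coset_def)
    show "real (card (S <#> S <#> S)) \<le> 2 ^ 53 * M ^ 11 / \<delta> ^ 32 * real (card D)" using SSS by (simp add: n_def)
    show "inv s \<in> S" if s: "s \<in> S" for s
    proof -
      have sc: "s \<in> carrier G" using s by (simp add: S_def)
      have "bij_betw prod.swap {(a, b) \<in> A \<times> A. inv a \<otimes> b = s} {(a, b) \<in> A \<times> A. inv a \<otimes> b = inv s}"
        using Ac sc by (auto simp: bij_betw_def inj_on_def image_iff inv_mult_group)
          (metis inv_closed inv_inv inv_mult_group)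
      then have "quot_reps G A s = quot_reps G A (inv s)"
        unfolding quot_reps_def by (rule bij_betw_same_card)
      then show ?thesis using s sc by (simp add: S_def)
    qed
  qed
qed

subsection \<open>Symmetric product sets\<close>

context group begin

lemma mem_set_inv: "A \<subseteq> carrier G \<Longrightarrow> x \<in> set_inv A \<longleftrightarrow> x \<in> carrier G \<and> inv x \<in> A"
  by (auto simp: SET_INV_def intro!: bexI[of _ "inv x"])

lemma set_power_carrier: "A \<subseteq> carrier G \<Longrightarrow> set_power G A k \<subseteq> carrier G"
  by (induction k) (auto simp: set_mult_def)

lemma set_power_add:
  assumes "A \<subseteq> carrier G"
  shows "set_power G A (j + k) = set_power G A j <#> set_power G A k"
proof (induction j)
  case 0
  have "{\<one>} <#> X = X" if "X \<subseteq> carrier G" for X using that by (force simp: set_mult_def)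
  then show ?case by (simp add: set_power_carrier[OF assms])
next
  case (Suc j)
  then show ?case by (simp add: set_mult_assoc assms set_power_carrier)
qed

lemma sym_power_carrier: "A \<subseteq> carrier G \<Longrightarrow> sym_power G A k \<subseteq> carrier G"
  unfolding sym_power_def by (rule set_power_carrier) (auto simp: mem_set_inv)

lemma sym_power_add:
  assumes "A \<subseteq> carrier G"
  shows "sym_power G A (j + k) = sym_power G A j <#> sym_power G A k"
  unfolding sym_power_def by (rule set_power_add) (use assms in \<open>auto simp: mem_set_inv\<close>)

lemma sym_power_mult:
  assumes "A \<subseteq> carrier G" "x \<in> sym_power G A j" "y \<in> sym_power G A k"
  shows "x \<otimes> y \<in> sym_power G A (j + k)"
  using assms by (auto simp: sym_power_add set_mult_def)

lemma sym_power_1: "A \<subseteq> carrier G \<Longrightarrow> sym_power G A 1 = A \<union> set_inv A \<union> {\<one>}"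
  by (force simp: sym_power_def set_mult_def mem_set_inv)

lemma sym_power_mono:
  assumes "A \<subseteq> carrier G" "j \<le> k"
  shows "sym_power G A j \<subseteq> sym_power G A k"
proof -
  have "\<one> \<in> sym_power G A i" for i
    by (induction i) (auto simp: sym_power_def set_mult_def intro!: bexI[of _ \<one>])
  then have "sym_power G A j \<subseteq> sym_power G A (j + (k - j))"
    using sym_power_mult[OF assms(1), of _ j \<one> "k - j"] sym_power_carrier[OF assms(1), of j]
    by (metis r_one subsetD subsetI)
  then show ?thesis using assms(2) by simp
qed

lemma sym_power_inv:
  assumes "A \<subseteq> carrier G" "x \<in> sym_power G A k"
  shows "inv x \<in> sym_power G A k"
  using assms(2)
proof (induction k arbitrary: x)
  case 0 then show ?case by (simp add: sym_power_def)
next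
  case (Suc k)
  then obtain u y where uy: "u \<in> sym_power G A 1" "y \<in> sym_power G A k" "x = u \<otimes> y"
    using sym_power_add[OF assms(1), of 1 k] by (auto simp: set_mult_def)
  then have c: "u \<in> carrier G" "y \<in> carrier G" using sym_power_carrier[OF assms(1)] by auto
  have "inv u \<in> sym_power G A 1"
    using uy(1) assms(1) c unfolding sym_power_1[OF assms(1)] by (auto simp: mem_set_inv subset_iff)
  then have "inv y \<otimes> inv u \<in> sym_power G A (k + 1)"
    by (rule sym_power_mult[OF assms(1) Suc.IH[OF uy(2)]])
  then show ?case using uy c by (simp add: inv_mult_group)
qed

end

subsection \<open>Self-convolution of symmetric measures\<close>

text \<open>The convolution square of \<mu> at \<open>x\<close>, for \<mu> carried by
  \<open>D\<close>; the sum is finite for finite \<open>D\<close> even if the group is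
  infinite.\<close>

definition conv_pow2 :: "('g, 'm) monoid_scheme \<Rightarrow> 'g set \<Rightarrow> ('g \<Rightarrow> real) \<Rightarrow> 'g \<Rightarrow> real" where
  "conv_pow2 G D \<mu> x = (\<Sum>(a, b) \<in> {(a, b) \<in> D \<times> D. a \<otimes>\<^bsub>G\<^esub> b = x}. \<mu> a * \<mu> b)"

text \<open>A symmetric probability measure carried by \<open>D\<close>. The set \<open>D\<close>
  only has to contain the support: points of mass 0 are allowed.\<close>

definition sym_prob :: "('g, 'm) monoid_scheme \<Rightarrow> 'g set \<Rightarrow> ('g \<Rightarrow> real) \<Rightarrow> bool" where
  "sym_prob G D \<mu> \<longleftrightarrow> D \<subseteq> carrier G \<and> finite D \<and> (\<forall>x\<in>D. inv\<^bsub>G\<^esub> x \<in> D \<and> \<mu> (inv\<^bsub>G\<^esub> x) = \<mu> x) \<and>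
    (\<forall>x. 0 \<le> \<mu> x) \<and> (\<forall>x. x \<notin> D \<longrightarrow> \<mu> x = 0) \<and> sum \<mu> D = 1"

context group begin

lemma conv_pow2_nonneg: "(\<And>x. 0 \<le> \<mu> x) \<Longrightarrow> 0 \<le> conv_pow2 G D \<mu> x"
  unfolding conv_pow2_def by (intro sum_nonneg) auto

lemma conv_pow2_eq:
  assumes "D \<subseteq> carrier G" "finite D" "\<And>x. x \<notin> D \<Longrightarrow> \<mu> x = 0" "x \<in> carrier G"
  shows "conv_pow2 G D \<mu> x = (\<Sum>a\<in>D. \<mu> a * \<mu> (inv a \<otimes> x))"
proof -
  have "conv_pow2 G D \<mu> x = (\<Sum>a | a \<in> D \<and> inv a \<otimes> x \<in> D. \<mu> a * \<mu> (inv a \<otimes> x))"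
    unfolding conv_pow2_def
  proof (rule sum.reindex_bij_witness[of _ "\<lambda>a. (a, inv a \<otimes> x)" fst])
    fix p assume p: "p \<in> {(a, b) \<in> D \<times> D. a \<otimes> b = x}"
    then have "inv (fst p) \<otimes> x = snd p"
      using assms(1) by (auto simp: subset_iff m_assoc[symmetric])
    then show "(fst p, inv (fst p) \<otimes> x) = p" "fst p \<in> {a. a \<in> D \<and> inv a \<otimes> x \<in> D}"
      "\<mu> (fst p) * \<mu> (inv (fst p) \<otimes> x) = (case p of (a, b) \<Rightarrow> \<mu> a * \<mu> b)"
      using p by (auto simp: prod_eq_iff)
  next
    fix a assume "a \<in> {a. a \<in> D \<and> inv a \<otimes> x \<in> D}"
    then show "(a, inv a \<otimes> x) \<in> {(a, b) \<in> D \<times> D. a \<otimes> b = x}"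
      using assms by (auto simp: subset_iff m_assoc[symmetric])
  qed auto
  also have "\<dots> = (\<Sum>a\<in>D. \<mu> a * \<mu> (inv a \<otimes> x))"
    by (rule sum.mono_neutral_left) (use assms in auto)
  finally show ?thesis .
qed

lemma conv_pow2_inv:
  assumes "sym_prob G D \<mu>" "x \<in> carrier G"
  shows "conv_pow2 G D \<mu> (inv x) = conv_pow2 G D \<mu> x"
  unfolding conv_pow2_def
proof (rule sum.reindex_bij_witness[of _ "\<lambda>(a, b). (inv b, inv a)" "\<lambda>(a, b). (inv b, inv a)"])
  have c: "a \<in> carrier G" if "a \<in> D" for a using assms that by (auto simp: sym_prob_def)
  fix p assume p: "p \<in> {(a, b) \<in> D \<times> D. a \<otimes> b = inv x}"
  then show "(case p of (a, b) \<Rightarrow> (inv b, inv a)) \<in> {(a, b) \<in> D \<times> D. a \<otimes> b = x}"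
    using assms c by (auto simp: sym_prob_def inv_mult_group[symmetric])
  show "(case (case p of (a, b) \<Rightarrow> (inv b, inv a)) of (a, b) \<Rightarrow> (inv b, inv a)) = p"
    using p c by auto
  show "(case (case p of (a, b) \<Rightarrow> (inv b, inv a)) of (a, b) \<Rightarrow> \<mu> a * \<mu> b) = (case p of (a, b) \<Rightarrow> \<mu> a * \<mu> b)"
    using p assms by (auto simp: sym_prob_def)
next
  have c: "a \<in> carrier G" if "a \<in> D" for a using assms that by (auto simp: sym_prob_def)
  fix p assume p: "p \<in> {(a, b) \<in> D \<times> D. a \<otimes> b = x}"
  then show "(case p of (a, b) \<Rightarrow> (inv b, inv a)) \<in> {(a, b) \<in> D \<times> D. a \<otimes> b = inv x}"
    using assms c by (auto simp: sym_prob_def inv_mult_group[symmetric])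
  show "(case (case p of (a, b) \<Rightarrow> (inv b, inv a)) of (a, b) \<Rightarrow> (inv b, inv a)) = p"
    using p c by auto
qed

end

lemma sum_conv_pow2:
  assumes "finite D" "finite X"
  shows "(\<Sum>x\<in>X. conv_pow2 G D \<mu> x) = (\<Sum>(a, b) \<in> {(a, b) \<in> D \<times> D. a \<otimes>\<^bsub>G\<^esub> b \<in> X}. \<mu> a * \<mu> b)"
proof -
  have "{(a, b) \<in> D \<times> D. a \<otimes>\<^bsub>G\<^esub> b \<in> X} = (\<Union>x\<in>X. {(a, b) \<in> D \<times> D. a \<otimes>\<^bsub>G\<^esub> b = x})" by auto
  moreover have "finite {(a, b) \<in> D \<times> D. a \<otimes>\<^bsub>G\<^esub> b = x}" for x
    by (rule finite_subset[of _ "D \<times> D"]) (use assms in auto)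
  ultimately show ?thesis
    unfolding conv_pow2_def by (simp, subst sum.UNION_disjoint) (use assms in auto)
qed

lemma sum_pairs_of_prob: "finite D \<Longrightarrow> sum \<mu> D = (1::real) \<Longrightarrow> (\<Sum>(a, b) \<in> D \<times> D. \<mu> a * \<mu> b) = 1"
  by (simp add: sum.cartesian_product[symmetric] sum_product[symmetric])

section \<open>Symmetry sets and the mass that a convolution puts on them\<close>

context group_action begin

lemma act_mult: "\<lbrakk>x \<in> E; g \<in> carrier G; h \<in> carrier G\<rbrakk> \<Longrightarrow> \<phi> (g \<otimes> h) x = \<phi> g (\<phi> h x)"
  by (rule composition_rule)

lemma act_in: "\<lbrakk>x \<in> E; g \<in> carrier G\<rbrakk> \<Longrightarrow> \<phi> g x \<in> E"
  using element_image by blast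

lemma act_inv: "\<lbrakk>x \<in> E; g \<in> carrier G\<rbrakk> \<Longrightarrow> \<phi> (inv g) (\<phi> g x) = x"
  using orbit_sym_aux by blast

text \<open>Replaces the translate by the points that \<open>g\<close> keeps in \<open>Y\<close>,
  the form in which symmetry sets enter the double counting.\<close>

lemma card_Int_translate:
  assumes "Y \<subseteq> E" "g \<in> carrier G"
  shows "card (Y \<inter> \<phi> g ` Y) = card {y \<in> Y. \<phi> g y \<in> Y}"
proof -
  have "inj_on (\<phi> g) Y" by (rule inj_onI) (metis act_inv assms subsetD)
  then have "card (\<phi> g ` {y \<in> Y. \<phi> g y \<in> Y}) = card {y \<in> Y. \<phi> g y \<in> Y}"
    by (intro card_image) (auto intro: inj_on_subset)
  moreover have "\<phi> g ` {y \<in> Y. \<phi> g y \<in> Y} = Y \<inter> \<phi> g ` Y" by auto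
  ultimately show ?thesis by simp
qed

lemma mem_sym_set:
  assumes "Y \<subseteq> E"
  shows "g \<in> sym_set G \<phi> \<beta> Y \<longleftrightarrow> g \<in> carrier G \<and> \<beta> * real (card Y) \<le> real (card {y \<in> Y. \<phi> g y \<in> Y})"
  using card_Int_translate[OF assms, of g] by (auto simp: sym_set_def)

lemma sym_set_inv:
  assumes "Y \<subseteq> E" "g \<in> sym_set G \<phi> \<beta> Y"
  shows "inv g \<in> sym_set G \<phi> \<beta> Y"
proof -
  interpret group G using group_hom group_hom.axioms(1) by blast
  have g: "g \<in> carrier G" using assms by (simp add: sym_set_def)
  have "bij_betw (\<phi> g) {y \<in> Y. \<phi> g y \<in> Y} {y \<in> Y. \<phi> (inv g) y \<in> Y}"
    by (rule bij_betw_byWitness[where f' = "\<phi> (inv g)"])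
      (use g assms(1) act_inv[of _ g] act_inv[of _ "inv g"] in \<open>auto simp: subset_iff\<close>)
  then have "card {y \<in> Y. \<phi> g y \<in> Y} = card {y \<in> Y. \<phi> (inv g) y \<in> Y}" by (rule bij_betw_same_card)
  then show ?thesis using assms g by (simp add: mem_sym_set)
qed

lemma sym_set_antimono: "\<beta> \<le> \<alpha> \<Longrightarrow> sym_set G \<phi> \<alpha> Y \<subseteq> sym_set G \<phi> \<beta> Y"
  unfolding sym_set_def using mult_right_mono[of \<beta> \<alpha> "real (card Y)"] by fastforce

text \<open>Writing \<open>h(y)\<close> for the measure of \<open>{a. ay \<in> Y}\<close>, the second moment of \<open>h\<close> counts the \<open>y\<close> with
  \<open>ay, b\<inverse>y \<in> Y\<close>, and these are mapped by \<open>b\<inverse>\<close> to points that \<open>ab\<close> keeps in \<open>Y\<close>.\<close>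

lemma conv_pow2_mass:
  assumes Y: "Y \<subseteq> E" "finite Y" "Y \<noteq> {}" and \<mu>: "sym_prob G D \<mu>"
    and D: "D \<subseteq> sym_set G \<phi> \<alpha> Y" and \<alpha>: "0 < \<alpha>"
  shows "\<alpha>\<^sup>2 / 2 \<le> (\<Sum>x\<in>(D <#> D) \<inter> sym_set G \<phi> (\<alpha>\<^sup>2 / 2) Y. conv_pow2 G D \<mu> x)"
proof -
  interpret group G using group_hom group_hom.axioms(1) by blast
  have finD: "finite D" and DG: "D \<subseteq> carrier G" and nonneg: "\<And>x. 0 \<le> \<mu> x" and sum1: "sum \<mu> D = 1"
    and inv: "\<And>x. x \<in> D \<Longrightarrow> inv x \<in> D" "\<And>x. x \<in> D \<Longrightarrow> \<mu> (inv x) = \<mu> x"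
    using \<mu> by (auto simp: sym_prob_def)
  have Dc: "a \<in> carrier G" if "a \<in> D" for a using that DG by auto
  have Yc: "y \<in> E" if "y \<in> Y" for y using that Y by auto
  define N where "N = real (card Y)"
  have N: "N > 0" using Y by (simp add: N_def card_gt_0_iff)
  define h where "h y = (\<Sum>a\<in>D. \<mu> a * of_bool (\<phi> a y \<in> Y))" for y
  \<comment> \<open>By symmetry of \<mu> the same function is an average over inverses. Expanding
    h(y)^2 with one factor of each kind brings in both ay and b^-1 y.\<close>
  have h_inv: "h y = (\<Sum>b\<in>D. \<mu> b * of_bool (\<phi> (inv b) y \<in> Y))" for y
    unfolding h_def by (rule sum.reindex_bij_witness[of _ "\<lambda>a. inv a" "\<lambda>a. inv a"]) (auto simp: inv Dc)
  define W where "W a b = real (card {y \<in> Y. \<phi> a y \<in> Y \<and> \<phi> (inv b) y \<in> Y})" for a b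
  define T where "T = (D <#> D) \<inter> sym_set G \<phi> (\<alpha>\<^sup>2 / 2) Y"
  have finT: "finite T" using finD by (simp add: T_def set_mult_def)
  have count: "(\<Sum>y\<in>Y. of_bool (P y)) = real (card {y \<in> Y. P y})" for P
    using Y by (simp add: Int_def)
  have "\<alpha> * N = (\<Sum>a\<in>D. \<mu> a * (\<alpha> * N))" by (simp add: sum_distrib_right[symmetric] sum1)
  also have "\<dots> \<le> (\<Sum>a\<in>D. \<mu> a * real (card {y \<in> Y. \<phi> a y \<in> Y}))"
    by (intro sum_mono mult_left_mono nonneg) (use D in \<open>auto simp: mem_sym_set[OF Y(1)] N_def\<close>)
  also have "\<dots> = (\<Sum>a\<in>D. \<Sum>y\<in>Y. \<mu> a * of_bool (\<phi> a y \<in> Y))"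
    unfolding count[symmetric] sum_distrib_left ..
  also have "\<dots> = (\<Sum>y\<in>Y. h y)" unfolding h_def by (rule sum.swap)
  finally have "(\<alpha> * N)\<^sup>2 \<le> (\<Sum>y\<in>Y. h y)\<^sup>2" using \<alpha> N by (intro power_mono) auto
  also have "\<dots> \<le> (\<Sum>y\<in>Y. (h y)\<^sup>2) * N" unfolding N_def by (rule sum_squared_le_sum_of_squares)
  finally have hh: "\<alpha>\<^sup>2 * N \<le> (\<Sum>y\<in>Y. (h y)\<^sup>2)" using N by (simp add: power2_eq_square)
  have "(h y)\<^sup>2 = (\<Sum>(a, b)\<in>D \<times> D. \<mu> a * \<mu> b * of_bool (\<phi> a y \<in> Y \<and> \<phi> (inv b) y \<in> Y))" for y
  proof -
    have "(h y)\<^sup>2 = h y * (\<Sum>b\<in>D. \<mu> b * of_bool (\<phi> (inv b) y \<in> Y))"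
      using h_inv by (simp add: power2_eq_square)
    also have "\<dots> = (\<Sum>a\<in>D. \<Sum>b\<in>D. \<mu> a * of_bool (\<phi> a y \<in> Y) * (\<mu> b * of_bool (\<phi> (inv b) y \<in> Y)))"
      unfolding h_def by (rule sum_product)
    also have "\<dots> = (\<Sum>(a, b)\<in>D \<times> D. \<mu> a * \<mu> b * of_bool (\<phi> a y \<in> Y \<and> \<phi> (inv b) y \<in> Y))"
      unfolding sum.cartesian_product by (rule sum.cong) auto
    finally show ?thesis .
  qed
  then have "(\<Sum>y\<in>Y. (h y)\<^sup>2) = (\<Sum>y\<in>Y. \<Sum>p\<in>D \<times> D. \<mu> (fst p) * \<mu> (snd p) * of_bool (\<phi> (fst p) y \<in> Y \<and> \<phi> (inv (snd p)) y \<in> Y))"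
    by (simp add: case_prod_beta)
  also have "\<dots> = (\<Sum>p\<in>D \<times> D. \<Sum>y\<in>Y. \<mu> (fst p) * \<mu> (snd p) * of_bool (\<phi> (fst p) y \<in> Y \<and> \<phi> (inv (snd p)) y \<in> Y))"
    by (rule sum.swap)
  also have "\<dots> = (\<Sum>p\<in>D \<times> D. \<mu> (fst p) * \<mu> (snd p) * W (fst p) (snd p))"
    unfolding W_def count[symmetric] sum_distrib_left ..
  also have "\<dots> \<le> (\<Sum>p\<in>D \<times> D. N * (\<mu> (fst p) * \<mu> (snd p) * of_bool (fst p \<otimes> snd p \<in> T))
      + \<alpha>\<^sup>2 / 2 * N * (\<mu> (fst p) * \<mu> (snd p)))"
  proof (rule sum_mono)
    fix p assume p: "p \<in> D \<times> D"
    obtain a b where ab: "p = (a, b)" "a \<in> D" "b \<in> D" using p by auto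
    have abc: "a \<in> carrier G" "b \<in> carrier G" using ab Dc by auto
    \<comment> \<open>A product in \<open>T\<close> gets the trivial bound \<open>N\<close>; any
      other product lies outside the symmetry set and keeps at most \<alpha>^2 N/2 points in
      \<open>Y\<close>.\<close>
    have "W a b \<le> N * of_bool (a \<otimes> b \<in> T) + \<alpha>\<^sup>2 / 2 * N"
    proof (cases "a \<otimes> b \<in> T")
      case True
      have "W a b \<le> N" unfolding W_def N_def using Y by (auto intro!: card_mono)
      also have "\<dots> \<le> N * 1 + \<alpha>\<^sup>2 / 2 * N" using N by simp
      finally show ?thesis using True by simp
    next
      case False
      then have "a \<otimes> b \<notin> sym_set G \<phi> (\<alpha>\<^sup>2 / 2) Y" using ab by (auto simp: T_def set_mult_def)
      then have "real (card {y \<in> Y. \<phi> (a \<otimes> b) y \<in> Y}) \<le> \<alpha>\<^sup>2 / 2 * N"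
        using abc by (simp add: mem_sym_set[OF Y(1)] N_def)
      moreover have "card {y \<in> Y. \<phi> a y \<in> Y \<and> \<phi> (inv b) y \<in> Y} \<le> card {y \<in> Y. \<phi> (a \<otimes> b) y \<in> Y}"
      proof (rule card_inj_on_le[of "\<phi> (inv b)"])
        show "inj_on (\<phi> (inv b)) {y \<in> Y. \<phi> a y \<in> Y \<and> \<phi> (inv b) y \<in> Y}"
          using abc by (intro inj_onI) (metis (no_types, lifting) act_inv Yc inv_closed mem_Collect_eq)
        show "\<phi> (inv b) ` {y \<in> Y. \<phi> a y \<in> Y \<and> \<phi> (inv b) y \<in> Y} \<subseteq> {y \<in> Y. \<phi> (a \<otimes> b) y \<in> Y}"
          using abc act_inv[of _ "inv b"] by (auto simp: act_mult Yc act_in)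
      qed (use Y in auto)
      ultimately show ?thesis using N by (simp add: W_def)
    qed
    then have "\<mu> a * \<mu> b * W a b \<le> \<mu> a * \<mu> b * (N * of_bool (a \<otimes> b \<in> T) + \<alpha>\<^sup>2 / 2 * N)"
      by (rule mult_left_mono) (simp add: nonneg)
    then show "\<mu> (fst p) * \<mu> (snd p) * W (fst p) (snd p) \<le> N * (\<mu> (fst p) * \<mu> (snd p) * of_bool (fst p \<otimes> snd p \<in> T))
      + \<alpha>\<^sup>2 / 2 * N * (\<mu> (fst p) * \<mu> (snd p))"
      unfolding ab by (simp add: algebra_simps)
  qed
  also have "\<dots> = N * (\<Sum>p\<in>D \<times> D. \<mu> (fst p) * \<mu> (snd p) * of_bool (fst p \<otimes> snd p \<in> T)) + \<alpha>\<^sup>2 / 2 * N"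
    using sum_pairs_of_prob[OF finD sum1] unfolding case_prod_beta
    by (simp only: sum.distrib sum_distrib_left[symmetric] case_prod_beta mult_1_right)
  also have "(\<Sum>p\<in>D \<times> D. \<mu> (fst p) * \<mu> (snd p) * of_bool (fst p \<otimes> snd p \<in> T)) = (\<Sum>x\<in>T. conv_pow2 G D \<mu> x)"
    unfolding sum_conv_pow2[OF finD finT]
    by (rule sum.mono_neutral_cong_right) (use finD in auto)
  finally have "\<alpha>\<^sup>2 * N \<le> (\<Sum>x\<in>T. conv_pow2 G D \<mu> x) * N + \<alpha>\<^sup>2 / 2 * N"
    using hh by (simp add: mult.commute)
  then have "\<alpha>\<^sup>2 / 2 * N \<le> (\<Sum>x\<in>T. conv_pow2 G D \<mu> x) * N" by simp
  then show ?thesis using N unfolding T_def by (rule mult_right_le_imp_le)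
qed

text \<open>Restriction to a symmetry set followed by normalisation. Dividing by the surviving mass
  costs at most the factor \<open>1 / (\<alpha>\<^sup>2 / 2)\<close>, by
  \<open>conv_pow2_mass\<close>. Symmetry survives because both \<open>D <#> D\<close> and symmetry
  sets are closed under inverses.\<close>

lemma sym_prob_step:
  assumes Y: "Y \<subseteq> E" "finite Y" "Y \<noteq> {}" and \<mu>: "sym_prob G D \<mu>"
    and D: "D \<subseteq> sym_set G \<phi> \<alpha> Y" and \<alpha>: "0 < \<alpha>"
  obtains D' \<nu> where "sym_prob G D' \<nu>" "D' = (D <#> D) \<inter> sym_set G \<phi> (\<alpha>\<^sup>2 / 2) Y"
    "\<And>x. \<nu> x \<le> conv_pow2 G D \<mu> x / (\<alpha>\<^sup>2 / 2)"
proof -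
  interpret group G using group_hom group_hom.axioms(1) by blast
  define T where "T = (D <#> D) \<inter> sym_set G \<phi> (\<alpha>\<^sup>2 / 2) Y"
  define m where "m = (\<Sum>x\<in>T. conv_pow2 G D \<mu> x)"
  have \<mu>': "finite D" "D \<subseteq> carrier G" "\<And>x. 0 \<le> \<mu> x" "\<And>x. x \<in> D \<Longrightarrow> inv x \<in> D"
    using \<mu> by (auto simp: sym_prob_def)
  have m: "\<alpha>\<^sup>2 / 2 \<le> m" unfolding m_def T_def by (rule conv_pow2_mass[OF assms])
  then have m0: "0 < m" using \<alpha> by (smt (verit) half_gt_zero zero_less_power)
  have TG: "T \<subseteq> carrier G" by (auto simp: T_def sym_set_def)
  have Tinv: "inv x \<in> T" if xT: "x \<in> T" for x
  proof -
    obtain a b where "a \<in> D" "b \<in> D" "x = a \<otimes> b" "x \<in> sym_set G \<phi> (\<alpha>\<^sup>2 / 2) Y"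
      using xT by (auto simp: T_def set_mult_def)
    then show ?thesis using \<mu>' sym_set_inv[OF Y(1), of x]
      by (fastforce simp: T_def set_mult_def inv_mult_group subset_iff)
  qed
  define \<nu> where "\<nu> x = (if x \<in> T then conv_pow2 G D \<mu> x / m else 0)" for x
  show ?thesis
  proof
    show "sym_prob G T \<nu>"
      unfolding sym_prob_def
    proof (intro conjI ballI allI impI)
      show "finite T" using \<mu>' by (simp add: T_def set_mult_def)
      show "\<nu> (inv x) = \<nu> x" if "x \<in> T" for x
        using that Tinv TG conv_pow2_inv[OF \<mu>] by (auto simp: \<nu>_def)
      show "0 \<le> \<nu> x" for x using m0 conv_pow2_nonneg[OF \<mu>'(3)] by (simp add: \<nu>_def)
      show "sum \<nu> T = 1"
      proof -
        have "sum \<nu> T = m / m" unfolding m_def sum_divide_distrib by (rule sum.cong) (auto simp: \<nu>_def m_def)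
        then show ?thesis using m0 by simp
      qed
    qed (use TG Tinv in \<open>auto simp: \<nu>_def\<close>)
    show "\<nu> x \<le> conv_pow2 G D \<mu> x / (\<alpha>\<^sup>2 / 2)" for x
      using m m0 \<alpha> conv_pow2_nonneg[of \<mu> D x, OF \<mu>'(3)] by (auto simp: \<nu>_def intro!: divide_left_mono simp del: divide_divide_eq_right)
  qed (rule T_def)
qed
end

section \<open>From large energy of a measure to a set with many products in a small set\<close>

lemma sum_Un_le:
  fixes f :: "'a \<Rightarrow> real"
  assumes "finite A" "finite B" "\<And>x. 0 \<le> f x"
  shows "sum f (A \<union> B) \<le> sum f A + sum f B"
  using sum.union_inter[OF assms(1,2), of f] sum_nonneg[of "A \<inter> B" f] assms(3) by simp

text \<open>The convolution square is at most \<open>N\<close> pointwise and has total mass at most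
  1, so a second moment of N/L forces mass at least 1/(2L) on the set \<open>P\<close> of its large
  values. Discarding the points where \<mu> is much larger or smaller than \<open>N\<close> leaves a
  set on which \<mu> is constant up to powers of \<open>L\<close> and many products still fall in
  \<open>P\<close>.\<close>

lemma (in group) flatten_measure:
  fixes L N :: real
  assumes \<mu>: "sym_prob G D0 \<mu>" and L: "1 \<le> L" and N: "N = (\<Sum>x\<in>D0. (\<mu> x)\<^sup>2)"
    and X: "finite X" "N / L \<le> (\<Sum>x\<in>X. (conv_pow2 G D0 \<mu> x)\<^sup>2)"
  obtains D P where "0 < N" "D \<subseteq> D0" "P \<subseteq> X" "\<And>a. a \<in> D \<Longrightarrow> N / (32 * L\<^sup>2) \<le> \<mu> a"
    "1 / (32 * L\<^sup>2 * N) \<le> real (card D)"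
    "1 / (2 ^ 19 * L ^ 7) * real (card D) * real (card D) \<le> real (card {(a, b) \<in> D \<times> D. a \<otimes> b \<in> P})"
    "real (card P) \<le> 64 * L ^ 3 * real (card D)"
proof -
  have fin: "finite D0" and DG: "D0 \<subseteq> carrier G" and nonneg: "\<And>x. 0 \<le> \<mu> x" and sum1: "sum \<mu> D0 = 1"
    using \<mu> by (auto simp: sym_prob_def)
  have Dc: "a \<in> carrier G" if "a \<in> D0" for a using that DG by auto
  have "N \<noteq> 0"
  proof
    assume "N = 0"
    then have "sum \<mu> D0 = 0" using fin by (auto simp: N sum_nonneg_eq_0_iff)
    then show False using sum1 by simp
  qed
  then have N0: "0 < N" using sum_nonneg[of D0 "\<lambda>x. (\<mu> x)\<^sup>2"] by (auto simp: N)
  define f where "f = conv_pow2 G D0 \<mu>"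
  have f0: "0 \<le> f x" for x unfolding f_def by (rule conv_pow2_nonneg[OF nonneg])
  \<comment> \<open>By 2uv <= u^2 + v^2: a pair with product \<open>x\<close> is determined by
    either coordinate, so each of the two sums of squares is at most \<open>N\<close>.\<close>
  have fN: "f x \<le> N" for x
  proof -
    define F where "F = {(a, b) \<in> D0 \<times> D0. a \<otimes> b = x}"
    have "f x \<le> (\<Sum>p\<in>F. (\<mu> (fst p))\<^sup>2 / 2 + (\<mu> (snd p))\<^sup>2 / 2)"
      unfolding f_def conv_pow2_def F_def[symmetric]
    proof (rule sum_mono)
      fix p show "(case p of (a, b) \<Rightarrow> \<mu> a * \<mu> b) \<le> (\<mu> (fst p))\<^sup>2 / 2 + (\<mu> (snd p))\<^sup>2 / 2"
        using sum_squares_bound[of "\<mu> (fst p)" "\<mu> (snd p)"] by (simp add: case_prod_beta)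
    qed
    also have "\<dots> = (\<Sum>p\<in>F. (\<mu> (fst p))\<^sup>2) / 2 + (\<Sum>p\<in>F. (\<mu> (snd p))\<^sup>2) / 2"
      by (simp add: sum.distrib sum_divide_distrib)
    also have "(\<Sum>p\<in>F. (\<mu> (fst p))\<^sup>2) = (\<Sum>a\<in>fst ` F. (\<mu> a)\<^sup>2)"
      by (subst sum.reindex) (auto simp: F_def inj_on_def Dc)
    also have "\<dots> \<le> N" unfolding N by (rule sum_mono2) (use fin in \<open>auto simp: F_def\<close>)
    also have "(\<Sum>p\<in>F. (\<mu> (snd p))\<^sup>2) = (\<Sum>a\<in>snd ` F. (\<mu> a)\<^sup>2)"
      by (subst sum.reindex) (auto simp: F_def inj_on_def Dc)
    also have "\<dots> \<le> N" unfolding N by (rule sum_mono2) (use fin in \<open>auto simp: F_def\<close>)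
    finally show ?thesis by simp
  qed
  have sumf: "sum f Z \<le> 1" if "finite Z" for Z
  proof -
    have "sum f Z = (\<Sum>(a, b) \<in> {(a, b) \<in> D0 \<times> D0. a \<otimes> b \<in> Z}. \<mu> a * \<mu> b)"
      unfolding f_def by (rule sum_conv_pow2[OF fin that])
    also have "\<dots> \<le> (\<Sum>(a, b) \<in> D0 \<times> D0. \<mu> a * \<mu> b)"
      by (rule sum_mono2) (use fin nonneg in auto)
    finally show ?thesis using sum_pairs_of_prob[OF fin sum1] by simp
  qed
  \<comment> \<open>Values below N/(2L) contribute at most N/(2L) to the second moment, since the
    total mass is at most 1; half of the assumed bound is left on \<open>P\<close>.\<close>
  define P where "P = {x \<in> X. N / (2 * L) \<le> f x}"
  have PX: "P \<subseteq> X" and finP: "finite P" using X by (auto simp: P_def)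
  have "(\<Sum>x\<in>X - P. (f x)\<^sup>2) \<le> (\<Sum>x\<in>X - P. N / (2 * L) * f x)"
    unfolding power2_eq_square by (intro sum_mono mult_right_mono f0) (auto simp: P_def)
  also have "\<dots> \<le> N / (2 * L) * 1"
    unfolding sum_distrib_left[symmetric] using X N0 L by (intro mult_left_mono sumf) auto
  finally have tail: "(\<Sum>x\<in>X - P. (f x)\<^sup>2) \<le> N / (2 * L)" by simp
  have "N / L \<le> (\<Sum>x\<in>X - P. (f x)\<^sup>2) + (\<Sum>x\<in>P. (f x)\<^sup>2)"
    using X(2) sum.subset_diff[OF PX X(1), of "\<lambda>x. (f x)\<^sup>2"] by (simp add: f_def)
  also have "(\<Sum>x\<in>P. (f x)\<^sup>2) \<le> (\<Sum>x\<in>P. N * f x)"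
    unfolding power2_eq_square by (intro sum_mono mult_right_mono f0 fN)
  finally have "N / (2 * L) \<le> N * sum f P" using tail by (simp add: sum_distrib_left field_simps)
  then have fP: "1 / (2 * L) \<le> sum f P" using N0 L by (simp add: field_simps)
  have "real (card P) * (N / (2 * L)) \<le> sum f P" by (rule sum_bounded_below) (auto simp: P_def)
  then have "real (card P) * (N / (2 * L)) \<le> 1" using sumf[OF finP] by linarith
  then have cP: "real (card P) \<le> 2 * L / N" using N0 L by (simp add: field_simps)
  \<comment> \<open>The lower cut-off makes t|P| at most 1/(16L). The upper cut-off 8LN in
    \<open>H\<close> leaves mass at most 1/(8L) above it, by comparison with the sum of squares
    \<open>N\<close>.\<close>
  define t where "t = N / (32 * L\<^sup>2)"
  have t: "0 < t" using N0 L by (simp add: t_def)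
  have tP: "t * real (card P) \<le> 1 / (16 * L)"
  proof -
    have "t * real (card P) \<le> t * (2 * L / N)" using t cP by (intro mult_left_mono) auto
    also have "\<dots> = 1 / (16 * L)" using N0 L by (simp add: t_def field_simps power2_eq_square)
    finally show ?thesis .
  qed
  define H where "H = {a \<in> D0. 8 * L * N < \<mu> a}"
  define Lo where "Lo = {a \<in> D0. \<mu> a < t}"
  define D where "D = D0 - H - Lo"
  have finD: "finite D" "finite H" "finite Lo" using fin by (auto simp: D_def H_def Lo_def)
  define PP where "PP = {(a, b) \<in> D0 \<times> D0. a \<otimes> b \<in> P}"
  have finPP: "finite PP" by (rule finite_subset[of _ "D0 \<times> D0"]) (use fin in \<open>auto simp: PP_def\<close>)
  define w where "w p = \<mu> (fst p) * \<mu> (snd p)" for p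
  have w0: "0 \<le> w p" for p by (simp add: w_def nonneg)
  have wPP: "sum f P = sum w PP"
    unfolding f_def sum_conv_pow2[OF fin finP] PP_def w_def by (simp add: case_prod_beta)
  have "8 * L * N * sum \<mu> H \<le> (\<Sum>a\<in>H. (\<mu> a)\<^sup>2)"
    unfolding sum_distrib_left power2_eq_square by (intro sum_mono mult_right_mono nonneg) (auto simp: H_def)
  also have "\<dots> \<le> N" unfolding N by (rule sum_mono2) (use fin in \<open>auto simp: H_def\<close>)
  finally have muH: "sum \<mu> H \<le> 1 / (8 * L)" using N0 L by (simp add: field_simps)
  have wH1: "sum w (H \<times> D0) = sum \<mu> H" and wH2: "sum w (D0 \<times> H) = sum \<mu> H"
    using sum_product[of \<mu> H \<mu> D0] sum_product[of \<mu> D0 \<mu> H] sum1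
    by (simp_all add: w_def sum.cartesian_product case_prod_beta)
  \<comment> \<open>Such a pair is determined by its product in \<open>P\<close> and the coordinate
    \<open>u p\<close> opposite to the small one, so the total weight is at most |P| times t times
    the mass 1 of \<mu>.\<close>
  have low: "sum w Z \<le> t * real (card P)"
    if Z: "Z \<subseteq> PP" and u: "\<And>p. p \<in> Z \<Longrightarrow> w p \<le> t * \<mu> (u p) \<and> u p \<in> D0"
      and inj: "inj_on (\<lambda>p. (fst p \<otimes> snd p, u p)) Z" for Z u
  proof -
    have "sum w Z \<le> (\<Sum>p\<in>Z. t * \<mu> (u p))" by (rule sum_mono) (use u in auto)
    also have "\<dots> = (\<Sum>q\<in>(\<lambda>p. (fst p \<otimes> snd p, u p)) ` Z. t * \<mu> (snd q))"
      by (subst sum.reindex[OF inj]) simp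
    also have "\<dots> \<le> (\<Sum>q\<in>P \<times> D0. t * \<mu> (snd q))"
      by (rule sum_mono2) (use finP fin Z u t nonneg in \<open>auto simp: PP_def\<close>)
    also have "\<dots> = (\<Sum>x\<in>P. \<Sum>b\<in>D0. t * \<mu> b)"
      unfolding sum.cartesian_product by (rule sum.cong) auto
    finally show ?thesis by (simp add: sum_distrib_left[symmetric] sum1 mult.commute)
  qed
  have low1: "sum w {p \<in> PP. fst p \<in> Lo} \<le> t * real (card P)"
    by (rule low[where u = snd])
      (auto simp: PP_def Lo_def w_def inj_on_def Dc intro!: mult_right_mono nonneg)
  have low2: "sum w {p \<in> PP. snd p \<in> Lo} \<le> t * real (card P)"
  proof (rule low[where u = fst])
    fix p assume "p \<in> {p \<in> PP. snd p \<in> Lo}"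
    then show "w p \<le> t * \<mu> (fst p) \<and> fst p \<in> D0"
      unfolding w_def mult.commute[of t] by (auto simp: PP_def Lo_def intro!: mult_left_mono nonneg)
  qed (auto simp: PP_def inj_on_def Dc)
  define DD where "DD = {(a, b) \<in> D \<times> D. a \<otimes> b \<in> P}"
  have finDD: "finite DD" by (rule finite_subset[of _ "D \<times> D"]) (use finD in \<open>auto simp: DD_def\<close>)
  have "sum w PP \<le> sum w (DD \<union> (H \<times> D0 \<union> (D0 \<times> H \<union> ({p \<in> PP. fst p \<in> Lo} \<union> {p \<in> PP. snd p \<in> Lo}))))"
    by (rule sum_mono2) (use finDD finD fin finPP w0 in \<open>auto simp: PP_def DD_def D_def\<close>)
  also have "\<dots> \<le> sum w DD + (sum w (H \<times> D0) + (sum w (D0 \<times> H) + (sum w {p \<in> PP. fst p \<in> Lo} + sum w {p \<in> PP. snd p \<in> Lo})))"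
    using finDD finD fin finPP w0
    by (intro order_trans[OF sum_Un_le] add_left_mono) auto
  \<comment> \<open>Out of the mass 1/(2L), the two \<open>H\<close> parts take at most 1/(4L) and
    the two \<open>Lo\<close> parts at most 1/(8L), which leaves 1/(8L).\<close>
  finally have "1 / (2 * L) \<le> sum w DD + (1 / (8 * L) + (1 / (8 * L) + (1 / (16 * L) + 1 / (16 * L))))"
    using fP wPP wH1 wH2 muH low1 low2 tP by linarith
  then have "1 / (8 * L) \<le> sum w DD" using L by (simp add: field_simps)
  also have "\<dots> \<le> real (card DD) * ((8 * L * N) * (8 * L * N))"
  proof (rule sum_bounded_above)
    fix p assume "p \<in> DD"
    then have "\<mu> (fst p) \<le> 8 * L * N" "\<mu> (snd p) \<le> 8 * L * N" by (auto simp: DD_def D_def H_def)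
    then show "w p \<le> (8 * L * N) * (8 * L * N)"
      unfolding w_def using L N0 nonneg by (intro mult_mono) auto
  qed
  finally have cDD: "1 / (512 * L ^ 3 * N\<^sup>2) \<le> real (card DD)"
    using L N0 by (simp add: field_simps power2_eq_square power3_eq_cube)
  have DD_sub: "D \<subseteq> D0" by (auto simp: D_def)
  have "real (card D) * t \<le> sum \<mu> D" by (rule sum_bounded_below) (auto simp: D_def Lo_def not_less)
  also have "\<dots> \<le> sum \<mu> D0" by (rule sum_mono2) (use fin nonneg DD_sub in auto)
  finally have "real (card D) \<le> 1 / t" using t sum1 by (simp add: field_simps)
  then have cD: "real (card D) \<le> 32 * L\<^sup>2 / N" by (simp add: t_def)
  \<comment> \<open>Since |DD| is at most |D|^2, the lower bound for \<open>DD\<close> also bounds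
    |D| from below; squares are compared.\<close>
  have cD2: "(1 / (32 * L\<^sup>2 * N))\<^sup>2 \<le> (real (card D))\<^sup>2"
  proof -
    have "(1 / (32 * L\<^sup>2 * N))\<^sup>2 = 1 / (1024 * L ^ 4 * N\<^sup>2)"
      by (simp add: power_divide power_mult_distrib flip: power_mult)
    also have "\<dots> \<le> 1 / (512 * L ^ 3 * N\<^sup>2)"
      using L N0 power_increasing[of 3 4 L] by (intro divide_left_mono mult_right_mono mult_mono) auto
    also have "\<dots> \<le> real (card DD)" by (rule cDD)
    also have "card DD \<le> card (D \<times> D)" by (rule card_mono) (use finD in \<open>auto simp: DD_def\<close>)
    finally show ?thesis by (simp add: card_cartesian_product power2_eq_square)
  qed
  have cD3: "1 / (32 * L\<^sup>2 * N) \<le> real (card D)" by (rule power2_le_imp_le[OF cD2]) simp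
  show ?thesis
  proof
    show "N / (32 * L\<^sup>2) \<le> \<mu> a" if "a \<in> D" for a using that by (auto simp: D_def Lo_def t_def)
    have "1 / (2 ^ 19 * L ^ 7) * (real (card D) * real (card D)) \<le> 1 / (2 ^ 19 * L ^ 7) * ((32 * L\<^sup>2 / N) * (32 * L\<^sup>2 / N))"
      using cD L by (intro mult_left_mono mult_mono) auto
    also have "\<dots> = 1 / (512 * L ^ 3 * N\<^sup>2)"
      using L N0 by (simp add: field_simps eval_nat_numeral)
    finally show "1 / (2 ^ 19 * L ^ 7) * real (card D) * real (card D) \<le> real (card {(a, b) \<in> D \<times> D. a \<otimes> b \<in> P})"
      using cDD by (simp add: DD_def mult.assoc)
    have "2 * L / N = 64 * L ^ 3 * (1 / (32 * L\<^sup>2 * N))"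
      using L N0 by (simp add: field_simps eval_nat_numeral)
    also have "\<dots> \<le> 64 * L ^ 3 * real (card D)" using cD3 L by (intro mult_left_mono) auto
    finally show "real (card P) \<le> 64 * L ^ 3 * real (card D)" using cP by linarith
  qed (use N0 DD_sub PX cD3 in auto)
qed

text \<open>If every step shrank \<open>N\<close> by more than the factor \<open>K\<close>, the
  telescoped product would contradict a total loss of at most K^J.\<close>

lemma geometric_pigeonhole:
  fixes N :: "nat \<Rightarrow> real"
  assumes "0 < K" "1 \<le> J" "N 0 \<le> K ^ J * N J"
  obtains j where "j < J" "N j \<le> K * N (Suc j)"
proof -
  have "\<exists>j<J. N j \<le> K * N (Suc j)"
  proof (rule ccontr)
    assume "\<not> ?thesis"
    then have less: "K * N (Suc j) < N j" if "j < J" for j using that by auto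
    have "K ^ i * N i < N 0" if "1 \<le> i" "i \<le> J" for i
      using that
    proof (induction i rule: nat_induct_at_least)
      case base then show ?case using less[of 0] assms by simp
    next
      case (Suc i)
      have "K ^ i * (K * N (Suc i)) < K ^ i * N i"
        using less[of i] Suc assms by (intro mult_strict_left_mono) auto
      then show ?case using Suc by (simp add: mult_ac)
    qed
    from this[of J] show False using assms by simp
  qed
  then show ?thesis using that by blast
qed

section \<open>The chain of restricted convolution squares\<close>

context group_action begin

text \<open>Iterates \<open>sym_prob_step\<close>. The recursion al(j+1) = al(j)^2/2 matches the
  level and the loss of one step, and each step doubles the length of the products.\<close>

lemma measure_chain:
  fixes \<alpha> :: real
  defines "al \<equiv> (\<lambda>j::nat. 2 * (\<alpha> / 2) ^ (2 ^ j))"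
  assumes Y: "Y \<subseteq> E" "finite Y" "Y \<noteq> {}" and A: "A \<subseteq> sym_set G \<phi> \<alpha> Y" "finite A" "A \<noteq> {}" and \<alpha>: "0 < \<alpha>"
  obtains D \<mu> where "\<And>j. sym_prob G (D j) (\<mu> j)" "\<And>j. D j \<subseteq> sym_power G A (2 ^ j)"
    "\<And>j. D j \<subseteq> sym_set G \<phi> (al j) Y" "\<And>j x. \<mu> (Suc j) x \<le> conv_pow2 G (D j) (\<mu> j) x / al (Suc j)"
    "D 0 = A \<union> set_inv A" "\<And>x. \<mu> 0 x = of_bool (x \<in> D 0) / real (card (D 0))"
proof -
  interpret group G using group_hom group_hom.axioms(1) by blast
  have AG: "A \<subseteq> carrier G" using A by (auto simp: sym_set_def)
  define D0 where "D0 = A \<union> set_inv A"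
  define \<mu>0 where "\<mu>0 x = of_bool (x \<in> D0) / real (card D0)" for x
  have al_Suc: "al (Suc j) = (al j)\<^sup>2 / 2" for j
    by (simp add: al_def power_even_eq power_mult_distrib)
  have al0: "0 < al j" for j using \<alpha> by (simp add: al_def)
  \<comment> \<open>The last clause pins the initial pair; dependent choice alone could start from
    any pair satisfying the invariant.\<close>
  define P where "P n p \<longleftrightarrow> sym_prob G (fst p) (snd p) \<and> fst p \<subseteq> sym_power G A (2 ^ n) \<and> fst p \<subseteq> sym_set G \<phi> (al n) Y
     \<and> (n = 0 \<longrightarrow> p = (D0, \<mu>0))" for n p
  define Q where "Q n p q \<longleftrightarrow> (\<forall>x. snd q x \<le> conv_pow2 G (fst p) (snd p) x / al (Suc n))" for n and p q :: "'a set \<times> ('a \<Rightarrow> real)"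
  have "\<exists>f. \<forall>n. P n (f n) \<and> Q n (f n) (f (Suc n))"
  proof (rule dependent_nat_choice)
    have "finite (set_inv A)" using A by (simp add: SET_INV_def)
    then have "finite D0" "D0 \<noteq> {}" using A by (auto simp: D0_def)
    then have "sym_prob G D0 \<mu>0"
      using AG by (auto simp: sym_prob_def \<mu>0_def D0_def mem_set_inv subset_iff)
    moreover have "D0 \<subseteq> sym_power G A 1" using sym_power_1[OF AG] by (auto simp: D0_def)
    moreover have "D0 \<subseteq> sym_set G \<phi> \<alpha> Y"
    proof
      fix x assume "x \<in> D0"
      then have "x \<in> A \<or> x \<in> carrier G \<and> inv x \<in> A" using AG by (auto simp: D0_def mem_set_inv)
      then show "x \<in> sym_set G \<phi> \<alpha> Y"
        using A sym_set_inv[OF Y(1), of "inv x"] by auto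
    qed
    ultimately show "\<exists>p. P 0 p" by (auto simp: P_def al_def)
  next
    fix p n assume p: "P n p"
    obtain D' \<nu> where D': "sym_prob G D' \<nu>" "D' = (fst p <#> fst p) \<inter> sym_set G \<phi> ((al n)\<^sup>2 / 2) Y"
      "\<And>x. \<nu> x \<le> conv_pow2 G (fst p) (snd p) x / ((al n)\<^sup>2 / 2)"
      using sym_prob_step[OF Y, of "fst p" "snd p" "al n"] p al0 by (auto simp: P_def)
    have "fst p <#> fst p \<subseteq> sym_power G A (2 ^ Suc n)"
      using p sym_power_mult[OF AG, of _ "2 ^ n" _ "2 ^ n"] by (auto simp: P_def set_mult_def mult_2)
    then have "P (Suc n) (D', \<nu>) \<and> Q n p (D', \<nu>)"
      using D' by (auto simp: P_def Q_def al_Suc)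
    then show "\<exists>q. P (Suc n) q \<and> Q n p q" by blast
  qed
  then obtain f where f: "\<And>n. P n (f n)" "\<And>n. Q n (f n) (f (Suc n))" by blast
  have f0: "f 0 = (D0, \<mu>0)" using f(1)[of 0] by (simp add: P_def)
  show ?thesis
  proof (rule that[of "fst \<circ> f" "snd \<circ> f"])
  qed (use f f0 in \<open>auto simp: P_def Q_def D0_def \<mu>0_def\<close>)
qed

text \<open>Up to the factor 1/al(j+1), the next measure is dominated by an average of left
  translates of the present one, and some translate does at least as well as the average. The
  induction collects these translations into a single \<open>g\<close>.\<close>

lemma measure_chain_le:
  fixes \<alpha> :: real
  defines "al \<equiv> (\<lambda>j::nat. 2 * (\<alpha> / 2) ^ (2 ^ j))"
  assumes \<alpha>: "0 < \<alpha>" "\<alpha> < 1" and AG: "A \<subseteq> carrier G"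
    and D: "\<And>j. sym_prob G (D j) (\<mu> j)" "\<And>j. D j \<subseteq> sym_power G A (2 ^ j)"
    and step: "\<And>j x. \<mu> (Suc j) x \<le> conv_pow2 G (D j) (\<mu> j) x / al (Suc j)"
    and T: "finite T" "T \<subseteq> carrier G"
  shows "\<exists>g\<in>sym_power G A (2 ^ j). sum (\<mu> j) T \<le> (\<Sum>x\<in>T. \<mu> 0 (g \<otimes> x)) / al (Suc j)"
  using T
proof (induction j arbitrary: T)
  case 0
  interpret group G using group_hom group_hom.axioms(1) by blast
  have "\<one> \<in> sym_power G A (2 ^ 0)" using sym_power_1[OF AG] by simp
  moreover have "0 < al (Suc 0)" "al (Suc 0) \<le> 1"
    using \<alpha> power_mono[of \<alpha> 1 2] by (auto simp: al_def power_divide)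
  moreover have "(\<Sum>x\<in>T. \<mu> 0 (\<one> \<otimes> x)) = sum (\<mu> 0) T" using 0 by (intro sum.cong) auto
  moreover have "0 \<le> sum (\<mu> 0) T" using D(1)[of 0] by (auto simp: sym_prob_def intro!: sum_nonneg)
  ultimately show ?case by (intro bexI[of _ \<one>]) (auto simp: pos_le_divide_eq mult_left_le)
next
  case (Suc j)
  interpret group G using group_hom group_hom.axioms(1) by blast
  have al0: "0 < al i" for i using \<alpha> by (simp add: al_def)
  have al_Suc: "al (Suc j) = (al j)\<^sup>2 / 2" for j
    by (simp add: al_def power_even_eq power_mult_distrib)
  have \<mu>: "finite (D j)" "D j \<subseteq> carrier G" "\<And>x. 0 \<le> \<mu> j x" "\<And>x. x \<notin> D j \<Longrightarrow> \<mu> j x = 0" "sum (\<mu> j) (D j) = 1"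
    using D(1)[of j] by (auto simp: sym_prob_def)
  define F where "F a = (\<Sum>x\<in>T. \<mu> j (inv a \<otimes> x))" for a
  define s where "s = (\<Sum>x\<in>T. conv_pow2 G (D j) (\<mu> j) x)"
  have "s = (\<Sum>x\<in>T. \<Sum>a\<in>D j. \<mu> j a * \<mu> j (inv a \<otimes> x))"
    unfolding s_def by (rule sum.cong) (use Suc.prems \<mu> in \<open>auto intro!: conv_pow2_eq\<close>)
  also have "\<dots> = (\<Sum>a\<in>D j. \<mu> j a * F a)" unfolding F_def sum_distrib_left by (rule sum.swap)
  finally have s: "s = (\<Sum>a\<in>D j. \<mu> j a * F a)" .
  have "\<exists>a\<in>D j. s \<le> F a"
  proof (rule ccontr)
    assume *: "\<not> ?thesis"
    have "\<exists>a\<in>D j. \<mu> j a \<noteq> 0" using \<mu>(5) by (metis sum.neutral zero_neq_one)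
    then obtain a where a: "a \<in> D j" "\<mu> j a \<noteq> 0" by blast
    then have pos: "0 < \<mu> j a" using \<mu>(3)[of a] by simp
    have "(\<Sum>a\<in>D j. \<mu> j a * F a) < (\<Sum>a\<in>D j. \<mu> j a * s)"
    proof (rule sum_strict_mono_ex1)
      show "\<forall>x\<in>D j. \<mu> j x * F x \<le> \<mu> j x * s"
        using * \<mu>(3) by (intro ballI mult_left_mono) (auto simp: not_le less_imp_le)
      show "\<exists>x\<in>D j. \<mu> j x * F x < \<mu> j x * s"
        using * a pos by (intro bexI[of _ a] mult_strict_left_mono) (auto simp: not_le)
    qed (rule \<mu>(1))
    then show False using s \<mu>(5) by (simp add: sum_distrib_right[symmetric])
  qed
  then obtain a where a: "a \<in> D j" "s \<le> F a" by blast
  have ac: "a \<in> carrier G" using a \<mu> by auto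
  define T' where "T' = (\<lambda>x. inv a \<otimes> x) ` T"
  have inj: "inj_on (\<lambda>x. inv a \<otimes> x) T" using ac Suc.prems by (auto simp: inj_on_def subset_iff)
  have T': "finite T'" "T' \<subseteq> carrier G" using ac Suc.prems by (auto simp: T'_def)
  obtain g where g: "g \<in> sym_power G A (2 ^ j)" "sum (\<mu> j) T' \<le> (\<Sum>x\<in>T'. \<mu> 0 (g \<otimes> x)) / al (Suc j)"
    using Suc.IH[OF T'] by blast
  have gc: "g \<in> carrier G" using g sym_power_carrier[OF AG] by auto
  have ga: "g \<otimes> inv a \<in> sym_power G A (2 ^ Suc j)"
    using sym_power_mult[OF AG g(1) sym_power_inv[OF AG], of a "2 ^ j"] a D(2)[of j] by (auto simp: mult_2)
  define z where "z = (\<Sum>x\<in>T. \<mu> 0 ((g \<otimes> inv a) \<otimes> x))"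
  have z0: "0 \<le> z" unfolding z_def using D(1)[of 0] by (auto simp: sym_prob_def intro!: sum_nonneg)
  have "(\<Sum>x\<in>T'. \<mu> 0 (g \<otimes> x)) = z"
    unfolding T'_def z_def using Suc.prems ac gc
    by (subst sum.reindex[OF inj]) (auto intro!: sum.cong simp: m_assoc subset_iff)
  moreover have "sum (\<mu> j) T' = F a" unfolding T'_def F_def by (subst sum.reindex[OF inj]) simp
  ultimately have "s \<le> z / al (Suc j)" using g(2) a(2) by simp
  have "sum (\<mu> (Suc j)) T \<le> s / al (Suc j)"
    unfolding s_def sum_divide_distrib by (rule sum_mono) (rule step)
  also have "\<dots> \<le> z / al (Suc j) / al (Suc j)"
    using \<open>s \<le> z / al (Suc j)\<close> al0[of "Suc j"] by (intro divide_right_mono) auto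
  \<comment> \<open>The recursion al(j+1)^2 = 2 al(j+2) absorbs the squared denominator, so the
    accumulated loss is again a single factor, with index one higher.\<close>
  also have "\<dots> = (z / 2) / al (Suc (Suc j))" by (simp add: al_Suc[of "Suc j"] power2_eq_square)
  also have "\<dots> \<le> z / al (Suc (Suc j))" using z0 al0[of "Suc (Suc j)"] by (intro divide_right_mono) auto
  finally show ?case using ga by (auto simp: z_def)
qed

end

subsection \<open>Covering by quotient sets\<close>

definition coincidences :: "('g \<Rightarrow> 'x \<Rightarrow> 'x) \<Rightarrow> 'g set \<Rightarrow> 'x \<Rightarrow> nat" where
  "coincidences \<phi> B z = card {(b1, b2) \<in> B \<times> B. \<phi> b1 z = \<phi> b2 z}"

lemma finite_coincidences: "finite B \<Longrightarrow> finite {(b1, b2) \<in> B \<times> B. \<phi> b1 z = \<phi> b2 z}"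
  by (rule finite_subset[of _ "B \<times> B"]) auto

context group_action begin

text \<open>Pairs (b1, b2) are grouped by g = b1^-1 b2, and b1 z = b2 z holds exactly when
  \<open>g\<close> fixes \<open>z\<close>. The diagonal pairs belong to the identity and contribute
  |B||Z|, which is the leading 1 of the bracket.\<close>

lemma fix_bracket_eq:
  assumes B: "B \<subseteq> carrier G" "finite B" "B \<noteq> {}" and Z: "Z \<subseteq> E" "finite Z" "Z \<noteq> {}"
  shows "fix_bracket G E \<phi> B Z = (\<Sum>z\<in>Z. real (coincidences \<phi> B z)) / (real (card B) * real (card Z))"
proof -
  interpret group G using group_hom group_hom.axioms(1) by blast
  define q where "q p = inv (fst p) \<otimes> snd p" for p
  define c where "c g = real (card (invariants E \<phi> g \<inter> Z))" for g
  have Bc: "b \<in> carrier G" if "b \<in> B" for b using that B by auto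
  have r: "quot_reps G B g = card {p \<in> B \<times> B. q p = g}" for g
    unfolding quot_reps_def q_def by (rule arg_cong[where f = card]) auto
  have one: "\<one> \<in> q ` (B \<times> B)"
  proof -
    obtain b where "b \<in> B" using B by auto
    then have "q (b, b) = \<one>" "(b, b) \<in> B \<times> B" using Bc by (auto simp: q_def)
    then show ?thesis by (metis image_eqI)
  qed
  have qc: "q ` (B \<times> B) \<subseteq> carrier G" using Bc by (auto simp: q_def)
  have fin: "finite (q ` (B \<times> B))" using B by simp
  have q1: "q p = \<one> \<longleftrightarrow> fst p = snd p" if "p \<in> B \<times> B" for p
    using that Bc by (auto simp: q_def) (metis inv_closed inv_equality inv_inv)
  have "{p \<in> B \<times> B. q p = \<one>} = (\<lambda>b. (b, b)) ` B" using q1 by (auto simp: image_iff)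
  then have r1: "quot_reps G B \<one> = card B" unfolding r by (simp add: card_image inj_on_def)
  have "invariants E \<phi> \<one> \<inter> Z = Z"
    using Z(1) id_eq_one[symmetric] by (auto simp: invariants_def)
  then have c1: "c \<one> = real (card Z)" by (simp add: c_def)
  \<comment> \<open>The summand vanishes off the finite set of quotients of \<open>B\<close>, so the
    infinite sum reduces to a finite one.\<close>
  have "(\<Sum>\<^sub>\<infinity>g\<in>carrier G - {\<one>}. c g * real (quot_reps G B g)) = (\<Sum>\<^sub>\<infinity>g\<in>q ` (B \<times> B) - {\<one>}. c g * real (quot_reps G B g))"
  proof (rule infsum_cong_neutral)
    fix x assume "x \<in> (carrier G - {\<one>}) - (q ` (B \<times> B) - {\<one>})"
    then have "{p \<in> B \<times> B. q p = x} = {}" by auto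
    then show "c x * real (quot_reps G B x) = 0" unfolding r by (metis card.empty mult_zero_right of_nat_0)
  qed (use qc in auto)
  also have "\<dots> = (\<Sum>g\<in>q ` (B \<times> B) - {\<one>}. c g * real (quot_reps G B g))"
    using fin by simp
  also have "\<dots> = (\<Sum>g\<in>q ` (B \<times> B). c g * real (quot_reps G B g)) - real (card Z) * real (card B)"
    using fin one by (simp add: sum_diff1 c1 r1)
  also have "(\<Sum>g\<in>q ` (B \<times> B). c g * real (quot_reps G B g)) = (\<Sum>g\<in>q ` (B \<times> B). \<Sum>p\<in>{p \<in> B \<times> B. q p = g}. c (q p))"
    unfolding r by (rule sum.cong) (auto simp: mult.commute)
  also have "\<dots> = (\<Sum>p\<in>B \<times> B. c (q p))"
    by (rule sum.image_gen[symmetric]) (use B in auto)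
  also have "\<dots> = (\<Sum>p\<in>B \<times> B. \<Sum>z\<in>Z. of_bool (\<phi> (fst p) z = \<phi> (snd p) z))"
  proof (rule sum.cong[OF refl])
    fix p assume p: "p \<in> B \<times> B"
    obtain a b where ab: "p = (a, b)" "a \<in> carrier G" "b \<in> carrier G" using p Bc by auto
    have "\<phi> (q p) z = z \<longleftrightarrow> \<phi> a z = \<phi> b z" if "z \<in> E" for z
    proof -
      have 1: "\<phi> (q p) z = \<phi> (inv a) (\<phi> b z)" using ab that by (simp add: q_def act_mult)
      have 2: "\<phi> (inv a) (\<phi> a z) = z" using ab that by (simp add: act_inv)
      have 3: "\<phi> a (\<phi> (inv a) (\<phi> b z)) = \<phi> b z" using ab that act_inv[of "\<phi> b z" "inv a"] by (simp add: act_in)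
      show ?thesis using 1 2 3 by metis
    qed
    then have "invariants E \<phi> (q p) \<inter> Z = {z \<in> Z. \<phi> a z = \<phi> b z}" using Z by (auto simp: invariants_def)
    then show "c (q p) = (\<Sum>z\<in>Z. of_bool (\<phi> (fst p) z = \<phi> (snd p) z))"
      using Z by (simp add: c_def ab Int_def)
  qed
  also have "\<dots> = (\<Sum>z\<in>Z. \<Sum>p\<in>B \<times> B. of_bool (\<phi> (fst p) z = \<phi> (snd p) z))" by (rule sum.swap)
  also have "\<dots> = (\<Sum>z\<in>Z. real (coincidences \<phi> B z))"
  proof (rule sum.cong[OF refl])
    fix z
    have "{p \<in> B \<times> B. \<phi> (fst p) z = \<phi> (snd p) z} = {(b1, b2) \<in> B \<times> B. \<phi> b1 z = \<phi> b2 z}" by auto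
    then show "(\<Sum>p\<in>B \<times> B. of_bool (\<phi> (fst p) z = \<phi> (snd p) z)) = real (coincidences \<phi> B z)"
      using B by (simp add: coincidences_def Int_def)
  qed
  finally have "(\<Sum>\<^sub>\<infinity>g\<in>carrier G - {\<one>}. c g * real (quot_reps G B g)) = (\<Sum>z\<in>Z. real (coincidences \<phi> B z)) - real (card Z) * real (card B)" .
  moreover have "card B > 0" "card Z > 0" using B Z by (auto simp: card_gt_0_iff)
  ultimately show ?thesis unfolding fix_bracket_def c_def by (simp add: field_simps)
qed

text \<open>Coincidences only grow with the set; the factor |S|/|B| corrects the normalisation of
  the bracket.\<close>

lemma fix_bracket_mono:
  assumes S: "S \<subseteq> carrier G" "finite S" and B: "B \<subseteq> S" "B \<noteq> {}" and Z: "Z \<subseteq> E" "finite Z" "Z \<noteq> {}"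
  shows "fix_bracket G E \<phi> B Z \<le> real (card S) / real (card B) * fix_bracket G E \<phi> S Z"
proof -
  have fB: "finite B" "S \<noteq> {}" "B \<subseteq> carrier G" using S B finite_subset by auto
  have pos: "card B > 0" "card S > 0" "card Z > 0" using fB S B Z by (auto simp: card_gt_0_iff)
  have "coincidences \<phi> B z \<le> coincidences \<phi> S z" for z
    unfolding coincidences_def
    by (rule card_mono[OF finite_coincidences[OF S(2)]]) (use B(1) in auto)
  then have "(\<Sum>z\<in>Z. real (coincidences \<phi> B z)) \<le> (\<Sum>z\<in>Z. real (coincidences \<phi> S z))"
    by (intro sum_mono) auto
  then show ?thesis
    using pos unfolding fix_bracket_eq[OF fB(3,1) B(2) Z] fix_bracket_eq[OF S fB(2) Z]
    by (simp add: divide_right_mono)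
qed

text \<open>\<open>Y'\<close> collects the points sent into W = uY by a proportion of at least
  \<beta>/2 of \<open>B\<close>. Maximality of \<open>Z\<close> gives b1 y = b2 z for each y in
  \<open>Y'\<close>, hence y = b1^-1 b2 z. The bound on |Z| takes two applications of
  Cauchy-Schwarz, one over the fibres at each z and one over \<open>Z\<close>, and the disjointness
  of the sets C(z) inside \<open>W\<close>.\<close>

lemma quotient_cover:
  fixes \<beta> :: real
  assumes Y: "Y \<subseteq> E" "finite Y" "Y \<noteq> {}" and B: "B \<subseteq> carrier G" "finite B" "B \<noteq> {}"
    and u: "u \<in> carrier G" and \<beta>: "0 < \<beta>" and sym: "\<And>b. b \<in> B \<Longrightarrow> inv u \<otimes> b \<in> sym_set G \<phi> \<beta> Y"
  obtains Y' Z where "Y' \<subseteq> Y" "\<beta> / 2 * real (card Y) \<le> real (card Y')" "Z \<subseteq> Y'" "Z \<noteq> {}"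
    "Y' \<subseteq> act_image \<phi> (set_inv B <#> B) Z"
    "real (card Z) \<le> 4 * real (card Y) / (\<beta>\<^sup>2 * real (card B)) * fix_bracket G E \<phi> B Z"
proof -
  interpret group G using group_hom group_hom.axioms(1) by blast
  have Bc: "b \<in> carrier G" if "b \<in> B" for b using that B by auto
  have Yc: "y \<in> E" if "y \<in> Y" for y using that Y by auto
  define n where "n = real (card B)"
  define N where "N = real (card Y)"
  have n: "n > 0" and N: "N > 0" using B Y by (auto simp: n_def N_def card_gt_0_iff)
  define W where "W = \<phi> u ` Y"
  define d where "d y = real (card {b \<in> B. \<phi> b y \<in> W})" for y
  have W: "\<phi> b y \<in> W \<longleftrightarrow> \<phi> (inv u \<otimes> b) y \<in> Y" if "y \<in> Y" "b \<in> B" for b y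
  proof -
    have e: "\<phi> (inv u \<otimes> b) y = \<phi> (inv u) (\<phi> b y)" using that Bc Yc u by (simp add: act_mult)
    have "\<phi> u (\<phi> (inv u) (\<phi> b y)) = \<phi> b y"
      using act_inv[of "\<phi> b y" "inv u"] that Bc Yc u by (simp add: act_in)
    then show ?thesis unfolding e W_def using act_inv[OF Yc u] by (auto simp: image_iff) metis
  qed
  have dn: "d y \<le> n" for y using B by (auto simp: d_def n_def intro!: card_mono)
  define Y' where "Y' = {y \<in> Y. \<beta> * n / 2 \<le> d y}"
  have Y': "Y' \<subseteq> Y" "finite Y'" using Y by (auto simp: Y'_def)
  have "\<beta> * N * n = (\<Sum>b\<in>B. \<beta> * N)" by (simp add: n_def)
  also have "\<dots> \<le> (\<Sum>b\<in>B. real (card {y \<in> Y. \<phi> b y \<in> W}))"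
  proof (rule sum_mono)
    fix b assume b: "b \<in> B"
    then have "{y \<in> Y. \<phi> b y \<in> W} = {y \<in> Y. \<phi> (inv u \<otimes> b) y \<in> Y}" using W by auto
    then show "\<beta> * N \<le> real (card {y \<in> Y. \<phi> b y \<in> W})"
      using sym[OF b] by (simp add: mem_sym_set[OF Y(1)] N_def)
  qed
  also have "\<dots> = (\<Sum>b\<in>B. \<Sum>y\<in>Y. of_bool (\<phi> b y \<in> W))" using Y by (simp add: Int_def)
  also have "\<dots> = (\<Sum>y\<in>Y. \<Sum>b\<in>B. of_bool (\<phi> b y \<in> W))" by (rule sum.swap)
  also have "\<dots> = (\<Sum>y\<in>Y. d y)" using B by (simp add: Int_def d_def)
  also have "\<dots> = (\<Sum>y\<in>Y - Y'. d y) + (\<Sum>y\<in>Y'. d y)" by (rule sum.subset_diff[OF Y'(1) Y(2)])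
  also have "(\<Sum>y\<in>Y'. d y) \<le> real (card Y') * n" by (rule sum_bounded_above) (rule dn)
  also have "(\<Sum>y\<in>Y - Y'. d y) \<le> real (card (Y - Y')) * (\<beta> * n / 2)"
    by (rule sum_bounded_above) (auto simp: Y'_def)
  also have "\<dots> \<le> N * (\<beta> * n / 2)"
    using Y n \<beta> by (intro mult_right_mono) (auto simp: N_def intro!: card_mono)
  finally have "\<beta> / 2 * N * n \<le> real (card Y') * n" by (simp add: field_simps)
  then have cY': "\<beta> / 2 * N \<le> real (card Y')" using n by (rule mult_right_le_imp_le)
  define C where "C y = (\<lambda>b. \<phi> b y) ` B \<inter> W" for y
  have finC: "finite (C y)" for y using B by (simp add: C_def)
  have "finite {Z. Z \<subseteq> Y' \<and> pairwise (\<lambda>y z. disjnt (C y) (C z)) Z}" using Y' by simp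
  then obtain Z where Z: "Z \<subseteq> Y'" "pairwise (\<lambda>y z. disjnt (C y) (C z)) Z"
    and max: "\<And>Z'. Z' \<subseteq> Y' \<Longrightarrow> pairwise (\<lambda>y z. disjnt (C y) (C z)) Z' \<Longrightarrow> Z \<subseteq> Z' \<Longrightarrow> Z = Z'"
  proof (rule finite_has_maximal[THEN bexE])
    have "{} \<in> {Z. Z \<subseteq> Y' \<and> pairwise (\<lambda>y z. disjnt (C y) (C z)) Z}" by simp
    then show "{Z. Z \<subseteq> Y' \<and> pairwise (\<lambda>y z. disjnt (C y) (C z)) Z} \<noteq> {}" by blast
  qed blast
  have finZ: "finite Z" and ZE: "Z \<subseteq> E" using Z Y' Y finite_subset[OF Z(1)] by auto
  have Cne: "C y \<noteq> {}" if "y \<in> Y'" for y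
  proof -
    have "0 < d y" using that \<beta> n by (auto simp: Y'_def) (smt (verit) mult_pos_pos half_gt_zero)
    then have "{b \<in> B. \<phi> b y \<in> W} \<noteq> {}" by (auto simp: d_def card_gt_0_iff)
    then show ?thesis by (auto simp: C_def)
  qed
  have meet: "\<exists>z\<in>Z. C y \<inter> C z \<noteq> {}" if y: "y \<in> Y'" for y
  proof (rule ccontr)
    assume *: "\<not> ?thesis"
    then have "pairwise (\<lambda>y z. disjnt (C y) (C z)) (insert y Z)"
      using Z(2) by (auto simp: pairwise_insert disjnt_def)
    \<comment> \<open>If \<open>y\<close> already lies in \<open>Z\<close>, it meets itself because
      \<open>C y\<close> is non-empty.\<close>
    then have "Z = insert y Z" using max[of "insert y Z"] y Z(1) by auto
    then show False using * Cne[OF y] by auto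
  qed
  have cover: "Y' \<subseteq> act_image \<phi> (set_inv B <#> B) Z"
  proof
    fix y assume y: "y \<in> Y'"
    then obtain z where z: "z \<in> Z" "C y \<inter> C z \<noteq> {}" using meet by blast
    then obtain b1 b2 where b: "b1 \<in> B" "b2 \<in> B" "\<phi> b1 y = \<phi> b2 z" by (auto simp: C_def)
    have c: "y \<in> E" "z \<in> E" using y z Z Y' Y by auto
    have "y = \<phi> (inv b1 \<otimes> b2) z" using act_inv[OF c(1) Bc[OF b(1)]] b c Bc by (simp add: act_mult)
    moreover have "inv b1 \<otimes> b2 \<in> set_inv B <#> B" using b by (auto simp: set_mult_def SET_INV_def)
    ultimately show "y \<in> act_image \<phi> (set_inv B <#> B) Z" using z by (auto simp: act_image_def)
  qed
  have "0 < real (card Y')" using cY' \<beta> N by (smt (verit) half_gt_zero mult_pos_pos)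
  then have "Y' \<noteq> {}" by auto
  then have Zne: "Z \<noteq> {}" using meet by blast
  \<comment> \<open>Cauchy--Schwarz on the fibres of \<open>b \<mapsto> bz\<close> over the points of \<open>W\<close>.\<close>
  have key: "(\<beta> * n / 2)\<^sup>2 \<le> real (card (C z)) * real (coincidences \<phi> B z)" if z: "z \<in> Z" for z
  proof -
    define m where "m x = {b \<in> B. \<phi> b z = x}" for x
    have finm: "finite (m x)" for x using B by (simp add: m_def)
    have "{b \<in> B. \<phi> b z \<in> W} = (\<Union>x\<in>C z. m x)" by (auto simp: C_def m_def)
    then have "card {b \<in> B. \<phi> b z \<in> W} = (\<Sum>x\<in>C z. card (m x))"
      by (simp, subst card_UN_disjoint) (use finC finm in \<open>auto simp: m_def\<close>)
    then have dz: "d z = (\<Sum>x\<in>C z. real (card (m x)))" by (simp add: d_def)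
    have "(\<beta> * n / 2)\<^sup>2 \<le> (d z)\<^sup>2" using z Z(1) \<beta> n by (intro power_mono) (auto simp: Y'_def)
    also have "\<dots> \<le> (\<Sum>x\<in>C z. (real (card (m x)))\<^sup>2) * real (card (C z))"
      unfolding dz by (rule sum_squared_le_sum_of_squares)
    finally have 1: "(\<beta> * n / 2)\<^sup>2 \<le> (\<Sum>x\<in>C z. (real (card (m x)))\<^sup>2) * real (card (C z))" .
    have "(\<Sum>x\<in>C z. (real (card (m x)))\<^sup>2) = real (\<Sum>x\<in>C z. card (m x \<times> m x))"
      by (simp add: card_cartesian_product power2_eq_square)
    also have "(\<Sum>x\<in>C z. card (m x \<times> m x)) = card (\<Union>x\<in>C z. m x \<times> m x)"
      by (rule card_UN_disjoint[symmetric]) (use finC finm in \<open>auto simp: m_def\<close>)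
    also have "\<dots> \<le> coincidences \<phi> B z" unfolding coincidences_def
      by (rule card_mono[OF finite_coincidences[OF B(2)]]) (auto simp: m_def)
    finally have "(\<Sum>x\<in>C z. (real (card (m x)))\<^sup>2) \<le> real (coincidences \<phi> B z)" by simp
    then have "(\<Sum>x\<in>C z. (real (card (m x)))\<^sup>2) * real (card (C z)) \<le> real (coincidences \<phi> B z) * real (card (C z))"
      by (rule mult_right_mono) simp
    with 1 show ?thesis by (simp add: mult.commute)
  qed
  have "(\<Sum>z\<in>Z. card (C z)) = card (\<Union>z\<in>Z. C z)"
    by (rule card_UN_disjoint[symmetric]) (use finZ finC Z(2) in \<open>auto simp: pairwise_def disjnt_def\<close>)
  also have "\<dots> \<le> card W" by (rule card_mono) (use Y in \<open>auto simp: W_def C_def\<close>)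
  also have "\<dots> \<le> card Y" unfolding W_def using Y by (intro card_image_le)
  finally have CW: "(\<Sum>z\<in>Z. real (card (C z))) \<le> N" unfolding N_def of_nat_sum[symmetric] of_nat_le_iff .
  define q where "q = (\<Sum>z\<in>Z. real (coincidences \<phi> B z))"
  have q0: "0 \<le> q" by (auto simp: q_def intro: sum_nonneg)
  \<comment> \<open>The second Cauchy-Schwarz: \<open>key\<close> enters as a product of square
    roots, whose squares sum over \<open>Z\<close> to at most |Y| and to the total number
    \<open>q\<close> of coincidences.\<close>
  have "real (card Z) * (\<beta> * n / 2) = (\<Sum>z\<in>Z. \<beta> * n / 2)" by simp
  also have "\<dots> \<le> (\<Sum>z\<in>Z. sqrt (real (card (C z))) * sqrt (real (coincidences \<phi> B z)))"
  proof (rule sum_mono)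
    fix z assume "z \<in> Z"
    then show "\<beta> * n / 2 \<le> sqrt (real (card (C z))) * sqrt (real (coincidences \<phi> B z))"
      using real_le_rsqrt[OF key] by (simp only: real_sqrt_mult)
  qed
  finally have "(real (card Z) * (\<beta> * n / 2))\<^sup>2 \<le> (\<Sum>z\<in>Z. sqrt (real (card (C z))) * sqrt (real (coincidences \<phi> B z)))\<^sup>2"
    using \<beta> n by (intro power_mono) auto
  also have "\<dots> \<le> (\<Sum>z\<in>Z. (sqrt (real (card (C z))))\<^sup>2) * (\<Sum>z\<in>Z. (sqrt (real (coincidences \<phi> B z)))\<^sup>2)"
    by (rule Cauchy_Schwarz_ineq_sum)
  also have "\<dots> = (\<Sum>z\<in>Z. real (card (C z))) * q" by (simp add: q_def)
  also have "\<dots> \<le> N * q" using CW q0 by (rule mult_right_mono)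
  finally have *: "(real (card Z) * (\<beta> * n / 2))\<^sup>2 \<le> N * q" .
  have cZ: "0 < real (card Z)" using finZ Zne by (simp add: card_gt_0_iff)
  \<comment> \<open>The inequality is quadratic in |Z|; one factor stays on the left and the other
    becomes the normalisation of the bracket.\<close>
  have "real (card Z) \<le> 4 * N / (\<beta>\<^sup>2 * n) * (q / (n * real (card Z)))"
    using * cZ n \<beta> by (simp add: field_simps power2_eq_square)
  then have "real (card Z) \<le> 4 * real (card Y) / (\<beta>\<^sup>2 * real (card B)) * fix_bracket G E \<phi> B Z"
    unfolding fix_bracket_eq[OF B ZE finZ Zne] by (simp add: n_def N_def q_def)
  then show ?thesis using that[OF Y'(1) _ Z(1) Zne cover] cY' by (simp add: N_def)
qed

end

subsection \<open>Structure of symmetry sets\<close>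

context group begin

lemma l_coset_inv_cancel:
  assumes "c \<in> carrier G" "A \<subseteq> carrier G"
  shows "c <# (inv c <# A) = A"
  using assms by (simp add: lcos_m_assoc lcos_mult_one)

lemma card_l_coset:
  assumes "c \<in> carrier G" "A \<subseteq> carrier G"
  shows "card (c <# A) = card A"
proof -
  have "c <# A = (\<lambda>x. c \<otimes> x) ` A" by (auto simp: l_coset_def)
  moreover have "inj_on (\<lambda>x. c \<otimes> x) A" using assms by (auto simp: inj_on_def subset_iff)
  ultimately show ?thesis by (simp add: card_image)
qed

lemma card_set_mult_self_le:
  assumes "S \<subseteq> carrier G" "finite S"
  shows "card (S <#> S) \<le> card (S <#> S <#> S)"
proof (cases "S = {}")
  case False
  then obtain s where s: "s \<in> S" by auto
  show ?thesis
  proof (rule card_inj_on_le[of "\<lambda>x. x \<otimes> s"])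
    show "inj_on (\<lambda>x. x \<otimes> s) (S <#> S)"
      using assms s by (auto simp: inj_on_def set_mult_def subset_iff)
    show "(\<lambda>x. x \<otimes> s) ` (S <#> S) \<subseteq> S <#> S <#> S" using s by (auto simp: set_mult_def)
    show "finite (S <#> S <#> S)" using assms by (simp add: set_mult_def)
  qed
qed (simp add: set_mult_def)

end

text \<open>The set is found in a translate of \<open>Sym\<^sub>\<beta>(Y)\<close> with \<open>\<beta> = \<alpha>\<^sub>j\<close> for some \<open>j < J\<close>. Since \<open>\<beta>\<^sup>2 = 2\<alpha>\<^sub>j\<^sub>+\<^sub>1 \<ge> 2\<alpha>\<^sub>J\<close>,
  the loss \<open>4/\<beta>\<^sup>2\<close> in the covering lemma becomes exactly \<open>2/\<alpha>\<^sub>J\<close>.\<close>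

lemma (in group_action) approximate_group_in_sym_set:
  fixes \<alpha> K :: real and J :: nat
  defines "al \<equiv> (\<lambda>j::nat. 2 * (\<alpha> / 2) ^ (2 ^ j))" and "L \<equiv> K / (2 * (\<alpha> / 2) ^ (2 ^ J))\<^sup>2"
  assumes Y: "Y \<subseteq> E" "finite Y" "Y \<noteq> {}" and A: "A \<subseteq> sym_set G \<phi> \<alpha> Y" "finite A" "A \<noteq> {}"
    and \<alpha>: "0 < \<alpha>" "\<alpha> < 1" and J: "1 \<le> J" and fin: "finite (sym_set G \<phi> (al J) Y)"
    and K: "1 \<le> K" "K ^ J = real (card (sym_set G \<phi> (al J) Y)) / real (card A)"
  obtains gs As \<beta> where "gs \<in> sym_power G A (2 ^ J)" "As \<subseteq> carrier G" "finite As" "As \<noteq> {}"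
    "0 < \<beta>" "2 * al J \<le> \<beta>\<^sup>2" "al J \<le> \<beta>" "inv gs <# As \<subseteq> sym_power G A (2 ^ J) \<inter> sym_set G \<phi> \<beta> Y"
    "real (card (As <#> As <#> As)) \<le> 2 ^ 795 * L ^ 281 * real (card As)"
    "real (card (As <#> set_inv As)) \<le> 2 ^ 795 * L ^ 281 * real (card As)"
    "\<And>S. S \<subseteq> carrier G \<Longrightarrow> \<exists>g\<in>sym_power G A (2 ^ (J + 1)).
       real (card (S \<inter> As)) / real (card As) * real (card A)
         \<le> 2 ^ 78 * L ^ 28 / al J * (real (card (set_inv A \<inter> (g <# S))) + real (card (A \<inter> (g <# S))))"
proof -
  interpret group G using group_hom group_hom.axioms(1) by blast
  have AG: "A \<subseteq> carrier G" using A by (auto simp: sym_set_def)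
  have al0: "0 < al i" for i using \<alpha> by (simp add: al_def)
  have al_Suc: "al (Suc j) = (al j)\<^sup>2 / 2" for j
    by (simp add: al_def power_even_eq power_mult_distrib)
  have al_mono: "al J \<le> al i" if "i \<le> J" for i
    unfolding al_def using \<alpha> that by (intro mult_left_mono power_decreasing power_increasing) auto
  have "al J \<le> al 0" by (rule al_mono) simp
  then have al1: "al J \<le> 1" using \<alpha> by (simp add: al_def)
  have L_al: "L = K / (al J)\<^sup>2" by (simp add: L_def al_def)
  have L: "1 \<le> L" using K(1) al0[of J] al1 power_le_one[of "al J" 2] by (simp add: L_al)
  obtain D \<mu> where prob: "\<And>j. sym_prob G (D j) (\<mu> j)" and D_pow: "\<And>j. D j \<subseteq> sym_power G A (2 ^ j)"
    and D_sym: "\<And>j. D j \<subseteq> sym_set G \<phi> (al j) Y"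
    and step: "\<And>j x. \<mu> (Suc j) x \<le> conv_pow2 G (D j) (\<mu> j) x / al (Suc j)"
    and D0: "D 0 = A \<union> set_inv A" and \<mu>0: "\<And>x. \<mu> 0 x = of_bool (x \<in> D 0) / real (card (D 0))"
    using measure_chain[OF Y A \<alpha>(1)] unfolding al_def by blast
  have finD: "finite (D i)" and DG: "D i \<subseteq> carrier G" and nonneg: "\<And>x. 0 \<le> \<mu> i x" and sum1: "sum (\<mu> i) (D i) = 1" for i
    using prob[of i] by (auto simp: sym_prob_def)
  have cA: "0 < card A" "card A \<le> card (D 0)" using A finD[of 0] D0 by (auto simp: card_gt_0_iff intro!: card_mono)
  define N where "N i = (\<Sum>x\<in>D i. (\<mu> i x)\<^sup>2)" for i
  have N0: "N 0 \<le> 1 / real (card A)"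
  proof -
    have "N 0 = (\<Sum>x\<in>D 0. (1 / real (card (D 0)))\<^sup>2)" unfolding N_def by (rule sum.cong) (auto simp: \<mu>0)
    also have "\<dots> = 1 / real (card (D 0))" by (simp add: power2_eq_square)
    also have "\<dots> \<le> 1 / real (card A)" using cA by (intro divide_left_mono) auto
    finally show ?thesis .
  qed
  \<comment> \<open>Cauchy-Schwarz on the support of the last measure. Together with
    \<open>N0\<close> the total decay over J steps is at most |Sym|/|A|, which is K^J.\<close>
  have NJ: "1 \<le> N J * real (card (sym_set G \<phi> (al J) Y))"
  proof -
    have "1 \<le> N J * real (card (D J))"
      using sum_squared_le_sum_of_squares[of "\<mu> J" "D J"] by (simp add: N_def sum1)
    also have "\<dots> \<le> N J * real (card (sym_set G \<phi> (al J) Y))"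
      using card_mono[OF fin D_sym[of J]] by (intro mult_left_mono) (auto simp: N_def intro!: sum_nonneg)
    finally show ?thesis .
  qed
  have "1 / real (card A) \<le> K ^ J * N J"
    using NJ cA(1) by (simp add: K(2) field_simps)
  then have "N 0 \<le> K ^ J * N J" using N0 by linarith
  then obtain j where j: "j < J" "N j \<le> K * N (Suc j)"
    using geometric_pigeonhole[of K J N] K(1) J by auto
  \<comment> \<open>On its support the next measure times al(j+1) lies below the convolution square,
    so a large norm of the next measure forces large energy of the present one.\<close>
  have "(al J)\<^sup>2 * N (Suc j) \<le> (al (Suc j))\<^sup>2 * N (Suc j)"
    using al_mono[of "Suc j"] al0[of J] j by (intro mult_right_mono power_mono) (auto simp: N_def intro!: sum_nonneg)
  also have "\<dots> \<le> (\<Sum>x\<in>D (Suc j). (conv_pow2 G (D j) (\<mu> j) x)\<^sup>2)"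
    unfolding N_def sum_distrib_left
  proof (rule sum_mono)
    fix x
    have "al (Suc j) * \<mu> (Suc j) x \<le> conv_pow2 G (D j) (\<mu> j) x"
      using step[of j x] al0[of "Suc j"] by (simp add: field_simps)
    then have "(al (Suc j) * \<mu> (Suc j) x)\<^sup>2 \<le> (conv_pow2 G (D j) (\<mu> j) x)\<^sup>2"
      using al0[of "Suc j"] nonneg by (intro power_mono) auto
    then show "(al (Suc j))\<^sup>2 * (\<mu> (Suc j) x)\<^sup>2 \<le> (conv_pow2 G (D j) (\<mu> j) x)\<^sup>2" by (simp add: power_mult_distrib)
  qed
  finally have conv: "N j / L \<le> (\<Sum>x\<in>D (Suc j). (conv_pow2 G (D j) (\<mu> j) x)\<^sup>2)"
  proof -
    have "N j / L = (al J)\<^sup>2 * (N j / K)" by (simp add: L_al)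
    also have "\<dots> \<le> (al J)\<^sup>2 * N (Suc j)"
      using j(2) K(1) by (intro mult_left_mono) (auto simp: field_simps)
    finally show "(al J)\<^sup>2 * N (Suc j) \<le> (\<Sum>x\<in>D (Suc j). (conv_pow2 G (D j) (\<mu> j) x)\<^sup>2) \<Longrightarrow> ?thesis" by linarith
  qed
  obtain F P where F: "0 < N j" "F \<subseteq> D j" "P \<subseteq> D (Suc j)" "\<And>a. a \<in> F \<Longrightarrow> N j / (32 * L\<^sup>2) \<le> \<mu> j a"
    "1 / (32 * L\<^sup>2 * N j) \<le> real (card F)"
    "1 / (2 ^ 19 * L ^ 7) * real (card F) * real (card F) \<le> real (card {(a, b) \<in> F \<times> F. a \<otimes> b \<in> P})"
    "real (card P) \<le> 64 * L ^ 3 * real (card F)"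
    using flatten_measure[OF prob[of j] L N_def finD conv] by blast
  have "0 < real (card F)" using F(1,5) L by (smt (verit) divide_pos_pos mult_pos_pos zero_less_power)
  then have Fne: "F \<noteq> {}" by auto
  have F': "F \<subseteq> carrier G" "finite F" "P \<subseteq> carrier G" "finite P"
    using F(2,3) DG finD finite_subset[OF F(2)] finite_subset[OF F(3)] by auto
  have pos: "0 < 1 / (2 ^ 19 * L ^ 7)" "0 < 64 * L ^ 3" using L by auto
  obtain c B S where S: "c \<in> F" "B \<subseteq> F" "(1 / (2 ^ 19 * L ^ 7)) ^ 3 / (24 * (64 * L ^ 3)) * real (card F) \<le> real (card B)"
    "S \<subseteq> carrier G" "finite S" "\<And>s. s \<in> S \<Longrightarrow> inv s \<in> S" "inv c <# B \<subseteq> S"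
    "real (card (S <#> S <#> S)) \<le> 2 ^ 53 * (64 * L ^ 3) ^ 11 / (1 / (2 ^ 19 * L ^ 7)) ^ 32 * real (card F)"
    using balog_szemeredi_gowers[OF F'(1,2) Fne F'(3,4) pos F(6,7)] by blast
  define As where "As = inv c <# B"
  have c: "c \<in> carrier G" and B: "B \<subseteq> carrier G" "finite B" using S(1,2) F' finite_subset[OF S(2)] by auto
  have AsG: "As \<subseteq> carrier G" unfolding As_def using c B by (intro l_coset_subset_G) auto
  have finAs: "finite As" using S(5,7) finite_subset by (auto simp: As_def)
  have cAs: "card As = card B" unfolding As_def using c B by (intro card_l_coset) auto
  have cB: "real (card F) \<le> 2 ^ 68 * L ^ 24 * real (card B)"
  proof -
    have "real (card F) = (24 * 64 * 2 ^ 57 * L ^ 24) * ((1 / (2 ^ 19 * L ^ 7)) ^ 3 / (24 * (64 * L ^ 3)) * real (card F))"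
      using L by (simp add: power_mult_distrib power_divide flip: power_mult power_add)
    also have "\<dots> \<le> (24 * 64 * 2 ^ 57 * L ^ 24) * real (card B)" using S(3) L by (intro mult_left_mono) auto
    also have "\<dots> \<le> 2 ^ 68 * L ^ 24 * real (card B)" using L by (intro mult_right_mono) auto
    finally show ?thesis .
  qed
  have "0 < real (card F)" using Fne F' by (simp add: card_gt_0_iff)
  then have cB0: "0 < real (card B)" using cB by (smt (verit) mult_eq_0_iff of_nat_0_le_iff)
  then have Asne: "As \<noteq> {}" using cAs by auto
  have SSS: "real (card (S <#> S <#> S)) \<le> 2 ^ 795 * L ^ 281 * real (card As)"
  proof -
    have "2 ^ 53 * (64 * L ^ 3) ^ 11 / (1 / (2 ^ 19 * L ^ 7)) ^ 32 = 2 ^ 727 * L ^ 257"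
      using L by (simp add: power_mult_distrib power_divide flip: power_mult power_add)
    then have "real (card (S <#> S <#> S)) \<le> 2 ^ 727 * L ^ 257 * real (card F)" using S(8) by simp
    also have "\<dots> \<le> 2 ^ 727 * L ^ 257 * (2 ^ 68 * L ^ 24 * real (card B))" using cB L by (intro mult_left_mono) auto
    also have "\<dots> = 2 ^ 795 * L ^ 281 * real (card As)" unfolding cAs by (simp flip: power_add)
    finally show ?thesis .
  qed
  show ?thesis
  \<comment> \<open>With gs = c^-1 the translate gs^-1 As is \<open>B\<close>, which lies in the
    support \<open>D j\<close>.\<close>
  proof (rule that[of "inv c" As "al j"])
    have D_J: "D j \<subseteq> sym_power G A (2 ^ J)"
      using D_pow[of j] sym_power_mono[OF AG, of "2 ^ j" "2 ^ J"] j(1) by (auto intro: power_increasing)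
    have c_pow: "c \<in> sym_power G A (2 ^ J)" using S(1) F(2) D_J by auto
    show "inv c \<in> sym_power G A (2 ^ J)" using c_pow by (rule sym_power_inv[OF AG])
    show "0 < al j" "al J \<le> al j" using al0 al_mono j by auto
    show "2 * al J \<le> (al j)\<^sup>2" using al_mono[of "Suc j"] j(1) by (simp add: al_Suc)
    have eqB: "inv (inv c) <# As = B" using c B by (simp add: As_def l_coset_inv_cancel)
    show "inv (inv c) <# As \<subseteq> sym_power G A (2 ^ J) \<inter> sym_set G \<phi> (al j) Y"
      unfolding eqB using S(2) F(2) D_J D_sym[of j] by blast
    have AsS: "As \<subseteq> S" using S(7) by (simp add: As_def)
    have "As <#> As <#> As \<subseteq> S <#> S <#> S" using AsS by (intro mono_set_mult)
    then have "card (As <#> As <#> As) \<le> card (S <#> S <#> S)"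
      using S(5) by (intro card_mono) (auto simp: set_mult_def)
    then show "real (card (As <#> As <#> As)) \<le> 2 ^ 795 * L ^ 281 * real (card As)" using SSS by linarith
    \<comment> \<open>Closure of \<open>S\<close> under inverses lets the bound for the triple
      product of \<open>S\<close> also control the quotient set of \<open>As\<close>, as the lower
      bound for Y' in (3) demands.\<close>
    have "set_inv As \<subseteq> S" using AsS S(6) by (auto simp: SET_INV_def)
    then have "As <#> set_inv As \<subseteq> S <#> S" using AsS by (intro mono_set_mult)
    then have "card (As <#> set_inv As) \<le> card (S <#> S)"
      using S(5) by (intro card_mono) (auto simp: set_mult_def)
    also have "\<dots> \<le> card (S <#> S <#> S)" using S(4,5) by (rule card_set_mult_self_le)
    finally show "real (card (As <#> set_inv As)) \<le> 2 ^ 795 * L ^ 281 * real (card As)" using SSS by linarith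
    fix U assume U: "U \<subseteq> carrier G"
    \<comment> \<open>Moving the intersection by \<open>c\<close> puts it inside \<open>F\<close>,
      where \<open>\<mu> j\<close> is bounded below pointwise. Its mass is bounded above through a
      translate of the uniform measure on \<open>D 0\<close>; comparing the two bounds gives
      (2).\<close>
    define T where "T = c <# (U \<inter> As)"
    have TB: "T \<subseteq> B" using eqB c by (auto simp: T_def l_coset_def)
    have T: "finite T" "T \<subseteq> carrier G" using TB B finite_subset by auto
    have cT: "card T = card (U \<inter> As)" unfolding T_def using c AsG by (intro card_l_coset) auto
    obtain g where g: "g \<in> sym_power G A (2 ^ j)" "sum (\<mu> j) T \<le> (\<Sum>x\<in>T. \<mu> 0 (g \<otimes> x)) / al (Suc j)"
      using measure_chain_le[OF \<alpha> AG prob D_pow step[unfolded al_def] T, of j] unfolding al_def by blast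
    have gc: "g \<in> carrier G" using g sym_power_carrier[OF AG] by auto
    have "g \<otimes> c \<in> sym_power G A (2 ^ J + 2 ^ J)"
      using sym_power_mult[OF AG _ c_pow, of g "2 ^ J"] g(1) sym_power_mono[OF AG, of "2 ^ j" "2 ^ J"] j(1)
      by (auto intro: power_increasing)
    then have gJ: "g \<otimes> c \<in> sym_power G A (2 ^ (J + 1))" by (simp add: mult_2)
    define V where "V = real (card (set_inv A \<inter> ((g \<otimes> c) <# U))) + real (card (A \<inter> ((g \<otimes> c) <# U)))"
    have "(\<Sum>x\<in>T. \<mu> 0 (g \<otimes> x)) = real (card {x \<in> T. g \<otimes> x \<in> D 0}) / real (card (D 0))"
      using T(1) by (simp add: \<mu>0 Int_def flip: sum_divide_distrib)
    also have "\<dots> \<le> V / real (card A)"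
    proof (rule frac_le)
      have "card {x \<in> T. g \<otimes> x \<in> D 0} \<le> card (set_inv A \<inter> ((g \<otimes> c) <# U) \<union> A \<inter> ((g \<otimes> c) <# U))"
      proof (rule card_inj_on_le[of "\<lambda>x. g \<otimes> x"])
        show "inj_on (\<lambda>x. g \<otimes> x) {x \<in> T. g \<otimes> x \<in> D 0}" using T gc by (auto simp: inj_on_def subset_iff)
        show "(\<lambda>x. g \<otimes> x) ` {x \<in> T. g \<otimes> x \<in> D 0} \<subseteq> set_inv A \<inter> ((g \<otimes> c) <# U) \<union> A \<inter> ((g \<otimes> c) <# U)"
          using gc c U by (auto simp: D0 T_def l_coset_def m_assoc subset_iff)
        show "finite (set_inv A \<inter> ((g \<otimes> c) <# U) \<union> A \<inter> ((g \<otimes> c) <# U))"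
          using A by (simp add: SET_INV_def)
      qed
      also have "\<dots> \<le> card (set_inv A \<inter> ((g \<otimes> c) <# U)) + card (A \<inter> ((g \<otimes> c) <# U))" by (rule card_Un_le)
      finally show "real (card {x \<in> T. g \<otimes> x \<in> D 0}) \<le> V" by (simp add: V_def)
    qed (use cA in \<open>simp_all add: V_def\<close>)
    finally have "sum (\<mu> j) T \<le> (V / real (card A)) / al (Suc j)"
      using g(2) al0[of "Suc j"] by (smt (verit) divide_right_mono)
    also have "\<dots> \<le> (V / real (card A)) / al J"
      using al_mono[of "Suc j"] j(1) al0 by (intro divide_left_mono) (auto simp: V_def)
    finally have upper: "sum (\<mu> j) T \<le> (V / real (card A)) / al J" .
    have "real (card T) * (N j / (32 * L\<^sup>2)) \<le> sum (\<mu> j) T"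
      by (rule sum_bounded_below) (use F(4) TB S(2) in auto)
    moreover have "1 / (2 ^ 78 * L ^ 28 * real (card As)) \<le> N j / (32 * L\<^sup>2)"
    proof -
      have "1 / (32 * L\<^sup>2 * N j) \<le> 2 ^ 68 * L ^ 24 * real (card As)" using F(5) cB cAs by simp
      then have "1 \<le> (2 ^ 68 * L ^ 24 * real (card As)) * (32 * L\<^sup>2 * N j)"
        using F(1) L by (simp add: pos_divide_le_eq)
      also have "\<dots> = (2 ^ 78 * L ^ 28 * real (card As)) * (N j / (32 * L\<^sup>2))"
        using L by (simp add: field_simps flip: power_add)
      finally show ?thesis using L cB0 cAs by (simp add: pos_divide_le_eq mult.commute)
    qed
    ultimately have "real (card T) * (1 / (2 ^ 78 * L ^ 28 * real (card As))) \<le> (V / real (card A)) / al J"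
      using upper by (smt (verit) mult_left_mono of_nat_0_le_iff)
    then have "real (card (U \<inter> As)) / real (card As) * real (card A) \<le> 2 ^ 78 * L ^ 28 / al J * V"
      using cT L cA(1) al0[of J] cB0 cAs by (simp add: field_simps)
    then show "\<exists>g\<in>sym_power G A (2 ^ (J + 1)). real (card (U \<inter> As)) / real (card As) * real (card A)
         \<le> 2 ^ 78 * L ^ 28 / al J * (real (card (set_inv A \<inter> (g <# U))) + real (card (A \<inter> (g <# U))))"
      using gJ unfolding V_def by blast
  qed (use AsG finAs Asne in auto)
qed

text \<open>Bookkeeping of constants. Losses are powers of L = K/\<alpha>J^2 and of 1/\<alpha>J;
  with x = K/\<alpha>J one has L <= x^2 and 1/\<alpha>J <= x, because K >= 1. The values 600 and
  2^800 leave room above the exponents that occur.\<close>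

lemma (in group_action) sym_set_structure:
  fixes \<alpha> \<alpha>J K :: real and J :: nat
  assumes Y: "Y \<subseteq> E" "finite Y" "Y \<noteq> {}" and AG: "A \<subseteq> carrier G" and A: "finite A" "A \<noteq> {}"
    and \<alpha>: "0 < \<alpha>" "\<alpha> < 1" and J: "1 \<le> J" and \<alpha>J: "\<alpha>J = 2 * (\<alpha> / 2) ^ 2 ^ J"
    and fin: "finite (sym_set G \<phi> \<alpha>J Y)"
    and K: "K = (real (card (sym_set G \<phi> \<alpha>J Y)) / real (card A)) powr (1 / real J)"
    and A_sym: "A \<subseteq> sym_set G \<phi> \<alpha> Y"
  shows "\<exists>gs\<in>sym_power G A (2 ^ J). \<exists>As. As \<subseteq> carrier G \<and> finite As \<and> As \<noteq> {} \<and>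
        (inv gs <# As \<subseteq> sym_power G A (2 ^ J) \<inter> sym_set G \<phi> \<alpha>J Y \<and>
         real (card (As <#> As <#> As)) \<le> 2 ^ 800 * ((K / \<alpha>J) powr 600 * real (card As)))
        \<and>
        (\<forall>S \<subseteq> carrier G. \<exists>g \<in> sym_power G A (2 ^ (J + 1)).
          (\<alpha>J / K) powr 600 * (real (card (S \<inter> As)) / real (card As)) * real (card A)
            \<le> 2 ^ 800 * (real (card (set_inv A \<inter> (g <# S))) + real (card (A \<inter> (g <# S)))))
        \<and>
        (\<forall>S B \<rho>. S \<subseteq> carrier G \<longrightarrow> B = As \<inter> S \<longrightarrow> B \<noteq> {} \<longrightarrow>
          \<rho> = real (card B) / real (card As) \<longrightarrow>
          (\<exists>Y' \<subseteq> Y.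
            real (card Y') \<ge> \<alpha>J * real (card B) / (2 * real (card (B <#> set_inv B))) * real (card Y) \<and>
            (\<rho> * \<alpha>J / K) powr 600 * real (card Y)
              \<le> 2 ^ 800 * (\<alpha>J * real (card B) / (2 * real (card (B <#> set_inv B))) * real (card Y)) \<and>
            (\<exists>Z \<subseteq> Y'. Y' \<subseteq> act_image \<phi> (set_inv B <#> B) Z \<and>
              real (card Z) \<le> 2 * real (card Y) / (\<alpha>J * real (card B)) * fix_bracket G E \<phi> B Z \<and>
              (finite S \<longrightarrow>
                2 * real (card Y) / (\<alpha>J * real (card B)) * fix_bracket G E \<phi> B Z
                  \<le> 2 ^ 800 * ((K / (\<rho> * \<alpha>J) * max 1 (real (card S) / real (card As))) powr 600
                         * (real (card Y) / real (card S)) * fix_bracket G E \<phi> S Z)))))"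
proof -
  interpret group G using group_hom group_hom.axioms(1) by blast
  have a0: "0 < \<alpha>J" using \<alpha> by (simp add: \<alpha>J)
  have "(\<alpha> / 2) ^ 2 ^ J \<le> (\<alpha> / 2) ^ 1" using \<alpha> by (intro power_decreasing) auto
  then have a1: "\<alpha>J \<le> \<alpha>" by (simp add: \<alpha>J)
  define x where "x = K / \<alpha>J"
  define L where "L = K / \<alpha>J\<^sup>2"
  define N where "N = real (card (sym_set G \<phi> \<alpha>J Y)) / real (card A)"
  have cA: "0 < card A" using A by (simp add: card_gt_0_iff)
  \<comment> \<open>The symmetry set at the lower level contains \<open>A\<close>; this is the
    source of K >= 1.\<close>
  have "A \<subseteq> sym_set G \<phi> \<alpha>J Y" using A_sym sym_set_antimono[OF a1] by blast
  then have "card A \<le> card (sym_set G \<phi> \<alpha>J Y)" using fin by (rule card_mono[rotated])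
  then have N1: "1 \<le> N" using cA by (simp add: N_def)
  then have K1: "1 \<le> K" unfolding K N_def[symmetric] by (intro ge_one_powr_ge_zero) auto
  have KJ: "K ^ J = N"
    unfolding K N_def[symmetric] using N1 J by (simp add: powr_realpow[symmetric] powr_powr)
  have ax: "1 \<le> \<alpha>J * x" using K1 a0 by (simp add: x_def)
  have x1: "1 \<le> x" using ax a1 \<alpha> a0 by (smt (verit) mult_less_cancel_right2 mult_nonneg_nonpos)
  have Lx: "L \<le> x\<^sup>2" using K1 a0 by (simp add: L_def x_def power_divide divide_right_mono power2_eq_square)
  have L0: "0 < L" using K1 a0 by (simp add: L_def)
  have Lpow: "L ^ k \<le> x ^ (2 * k)" for k
    using power_mono[OF Lx, of k] L0 by (simp add: power_mult)
  have x_powr: "x powr 600 = x ^ 600" "(\<alpha>J / K) powr 600 = 1 / x ^ 600"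
    using x1 K1 a0 by (simp_all add: powr_numeral x_def power_divide)
  obtain gs As \<beta> where gs: "gs \<in> sym_power G A (2 ^ J)" and As: "As \<subseteq> carrier G" "finite As" "As \<noteq> {}"
    and \<beta>: "0 < \<beta>" "2 * \<alpha>J \<le> \<beta>\<^sup>2" "\<alpha>J \<le> \<beta>" and sub: "inv gs <# As \<subseteq> sym_power G A (2 ^ J) \<inter> sym_set G \<phi> \<beta> Y"
    and trip: "real (card (As <#> As <#> As)) \<le> 2 ^ 795 * L ^ 281 * real (card As)"
    and quot: "real (card (As <#> set_inv As)) \<le> 2 ^ 795 * L ^ 281 * real (card As)"
    and trans: "\<And>S. S \<subseteq> carrier G \<Longrightarrow> \<exists>g\<in>sym_power G A (2 ^ (J + 1)).
       real (card (S \<inter> As)) / real (card As) * real (card A)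
         \<le> 2 ^ 78 * L ^ 28 / \<alpha>J * (real (card (set_inv A \<inter> (g <# S))) + real (card (A \<inter> (g <# S))))"
    using approximate_group_in_sym_set[OF Y A_sym A \<alpha> J _ K1, folded \<alpha>J, folded L_def, OF fin KJ[unfolded N_def]]
    by metis
  have gsc: "gs \<in> carrier G" using gs sym_power_carrier[OF AG] by auto
  have cAs: "0 < card As" using As by (simp add: card_gt_0_iff)
  have L600: "2 ^ 795 * L ^ 281 \<le> 2 ^ 800 * x ^ 600"
    using order_trans[OF Lpow power_increasing[OF _ x1]] L0 by (intro mult_mono) auto
  show ?thesis
  proof (rule bexI[OF _ gs], rule exI[of _ As], intro conjI allI impI)
    show "inv gs <# As \<subseteq> sym_power G A (2 ^ J) \<inter> sym_set G \<phi> \<alpha>J Y"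
      using sub sym_set_antimono[OF \<beta>(3)] by blast
    have "2 ^ 795 * L ^ 281 * real (card As) \<le> 2 ^ 800 * x ^ 600 * real (card As)"
      using L600 by (rule mult_right_mono) simp
    then show "real (card (As <#> As <#> As)) \<le> 2 ^ 800 * ((K / \<alpha>J) powr 600 * real (card As))"
      using trip unfolding x_def[symmetric] x_powr by (simp only: mult.assoc)
  next
    fix S assume "S \<subseteq> carrier G"
    from trans[OF this] obtain g where g: "g \<in> sym_power G A (2 ^ (J + 1))"
       "real (card (S \<inter> As)) / real (card As) * real (card A)
         \<le> 2 ^ 78 * L ^ 28 / \<alpha>J * (real (card (set_inv A \<inter> (g <# S))) + real (card (A \<inter> (g <# S))))" by blast
    define V where "V = real (card (set_inv A \<inter> (g <# S))) + real (card (A \<inter> (g <# S)))"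
    have "1 / \<alpha>J \<le> x" using ax a0 by (simp add: field_simps)
    then have "L ^ 28 * (1 / \<alpha>J) \<le> x ^ 56 * x" using Lpow[of 28] x1 a0 by (intro mult_mono) auto
    also have "\<dots> = x ^ 57" by (simp flip: power_Suc2)
    also have "\<dots> \<le> x ^ 600" by (rule power_increasing) (use x1 in auto)
    finally have "2 ^ 78 * (L ^ 28 * (1 / \<alpha>J)) \<le> 2 ^ 800 * x ^ 600" by (intro mult_mono) (use L0 a0 in auto)
    then have "2 ^ 78 * L ^ 28 / \<alpha>J * V \<le> 2 ^ 800 * x ^ 600 * V"
      by (intro mult_right_mono) (auto simp: V_def)
    then have "real (card (S \<inter> As)) / real (card As) * real (card A) \<le> 2 ^ 800 * V * x ^ 600"
      using g(2) unfolding V_def[symmetric] by (simp only: mult_ac)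
    then have "real (card (S \<inter> As)) / real (card As) * real (card A) / x ^ 600 \<le> 2 ^ 800 * V"
      by (subst pos_divide_le_eq) (use x1 in auto)
    then have "(\<alpha>J / K) powr 600 * (real (card (S \<inter> As)) / real (card As)) * real (card A) \<le> 2 ^ 800 * V"
      by (simp add: x_powr mult.commute)
    then show "\<exists>g \<in> sym_power G A (2 ^ (J + 1)).
          (\<alpha>J / K) powr 600 * (real (card (S \<inter> As)) / real (card As)) * real (card A)
            \<le> 2 ^ 800 * (real (card (set_inv A \<inter> (g <# S))) + real (card (A \<inter> (g <# S))))"
      using g(1) unfolding V_def by blast
  next
    fix S B \<rho>
    assume S: "S \<subseteq> carrier G" and B_def: "B = As \<inter> S" and Bne: "B \<noteq> {}" and \<rho>: "\<rho> = real (card B) / real (card As)"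
    have B: "B \<subseteq> carrier G" "finite B" and BAs: "B \<subseteq> As" using As by (auto simp: B_def)
    have cB: "0 < card B" using B Bne by (simp add: card_gt_0_iff)
    have \<rho>01: "0 < \<rho>" "\<rho> \<le> 1" using cB cAs card_mono[OF As(2) BAs] by (auto simp: \<rho>)
    define y where "y = real (card Y)"
    define b where "b = real (card B)"
    define bb where "bb = real (card (B <#> set_inv B))"
    have pos: "0 < y" "0 < b" using Y cB by (auto simp: y_def b_def card_gt_0_iff)
    have b_bb: "b \<le> bb"
    proof -
      obtain b0 where b0: "b0 \<in> B" using Bne by auto
      have "card B \<le> card (B <#> set_inv B)"
      proof (rule card_inj_on_le[of "\<lambda>x. x \<otimes> inv b0"])
        show "inj_on (\<lambda>x. x \<otimes> inv b0) B" using B b0 by (auto simp: inj_on_def subset_iff)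
        show "(\<lambda>x. x \<otimes> inv b0) ` B \<subseteq> B <#> set_inv B" using b0 by (auto simp: set_mult_def SET_INV_def)
        show "finite (B <#> set_inv B)" using B by (simp add: set_mult_def SET_INV_def)
      qed
      then show ?thesis by (simp add: b_def bb_def)
    qed
    have bb_le: "bb \<le> 2 ^ 795 * L ^ 281 * real (card As)"
    proof -
      have "B <#> set_inv B \<subseteq> As <#> set_inv As" using BAs by (auto simp: set_mult_def SET_INV_def)
      then have "card (B <#> set_inv B) \<le> card (As <#> set_inv As)"
        by (intro card_mono) (use As in \<open>auto simp: set_mult_def SET_INV_def\<close>)
      then show ?thesis using quot by (simp add: bb_def)
    qed
    obtain Y' Z where Y': "Y' \<subseteq> Y" "\<beta> / 2 * y \<le> real (card Y')" and Z: "Z \<subseteq> Y'" "Z \<noteq> {}"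
      "Y' \<subseteq> act_image \<phi> (set_inv B <#> B) Z" "real (card Z) \<le> 4 * y / (\<beta>\<^sup>2 * b) * fix_bracket G E \<phi> B Z"
      unfolding y_def b_def
    proof (rule quotient_cover[OF Y B Bne gsc \<beta>(1)])
      show "inv gs \<otimes> b \<in> sym_set G \<phi> \<beta> Y" if "b \<in> B" for b
        using sub that BAs by (auto simp: l_coset_def)
    qed blast
    have ZX: "Z \<subseteq> E" "finite Z" using finite_subset[OF Z(1) finite_subset[OF Y'(1) Y(2)]] Z(1) Y'(1) Y(1) by auto
    \<comment> \<open>The proportion \<beta>/2 from the covering lemma exceeds the stated one, since
      \<alpha>J <= \<beta> and |B| <= |B B^-1|.\<close>
    have low: "\<alpha>J * b / (2 * bb) * y \<le> \<beta> / 2 * y"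
    proof -
      have "\<alpha>J * b \<le> \<beta> * bb" using \<beta> b_bb a0 pos by (intro mult_mono) auto
      then have "\<alpha>J * b / (2 * bb) \<le> \<beta> / 2" using pos b_bb by (simp add: field_simps)
      then show ?thesis using pos by (intro mult_right_mono) auto
    qed
    have low2: "(\<rho> * \<alpha>J / K) powr 600 * y \<le> 2 ^ 800 * (\<alpha>J * b / (2 * bb) * y)"
    proof -
      have e: "\<rho> * \<alpha>J / K = \<rho> / x" using K1 a0 by (simp add: x_def)
      have "(\<rho> * \<alpha>J / K) powr 600 = (\<rho> / x) ^ 600" unfolding e using \<rho>01 x1 by (simp add: powr_numeral)
      also have "\<dots> = \<rho> ^ 600 / x ^ 600" by (rule power_divide)
      also have "\<dots> \<le> \<rho> / x ^ 600"
        using \<rho>01 x1 power_decreasing[of 1 600 \<rho>] by (intro divide_right_mono) auto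
      finally have 1: "(\<rho> * \<alpha>J / K) powr 600 \<le> \<rho> / x ^ 600" .
      have "L ^ 281 \<le> x ^ 562" using Lpow[of 281] by simp
      also have "\<dots> \<le> x ^ 562 * (\<alpha>J * x)" using ax x1 by (intro mult_le_cancel_left1[THEN iffD2]) auto
      also have "\<dots> = \<alpha>J * x ^ 563" by (simp flip: power_Suc2)
      also have "\<dots> \<le> \<alpha>J * x ^ 600" using a0 x1 by (intro mult_left_mono power_increasing) auto
      finally have 2: "L ^ 281 \<le> \<alpha>J * x ^ 600" .
      \<comment> \<open>Multiplication by \<rho> turns |As| into |B|; this single factor suffices
        because \<rho>^600 <= \<rho>.\<close>
      have "\<rho> * (2 * bb) \<le> \<rho> * (2 * (2 ^ 795 * L ^ 281 * real (card As)))"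
        using bb_le \<rho>01 by (intro mult_left_mono) auto
      also have "\<dots> = 2 ^ 796 * b * L ^ 281" using cAs by (simp add: \<rho> b_def)
      also have "\<dots> \<le> 2 ^ 800 * b * (\<alpha>J * x ^ 600)" using 2 pos L0 by (intro mult_mono) auto
      finally have "\<rho> / x ^ 600 \<le> 2 ^ 800 * (\<alpha>J * b / (2 * bb))"
        using x1 b_bb pos by (simp add: pos_divide_le_eq pos_le_divide_eq mult_ac)
      then have "(\<rho> * \<alpha>J / K) powr 600 \<le> 2 ^ 800 * (\<alpha>J * b / (2 * bb))" using 1 by linarith
      then have "(\<rho> * \<alpha>J / K) powr 600 * y \<le> 2 ^ 800 * (\<alpha>J * b / (2 * bb)) * y" using pos by (intro mult_right_mono) auto
      then show ?thesis by (simp only: mult.assoc)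
    qed
    have fb0: "0 \<le> fix_bracket G E \<phi> B Z"
      unfolding fix_bracket_eq[OF B Bne ZX Z(2)] by (intro divide_nonneg_nonneg sum_nonneg) auto
    have "2 * \<alpha>J * b \<le> \<beta>\<^sup>2 * b" using \<beta>(2) pos by (intro mult_right_mono) auto
    then have "4 * y / (\<beta>\<^sup>2 * b) \<le> 4 * y / (2 * \<alpha>J * b)" using pos a0 \<beta>(1) by (intro divide_left_mono) auto
    then have "4 * y / (\<beta>\<^sup>2 * b) * fix_bracket G E \<phi> B Z \<le> 2 * y / (\<alpha>J * b) * fix_bracket G E \<phi> B Z"
      using fb0 by (intro mult_right_mono) auto
    then have Zle: "real (card Z) \<le> 2 * y / (\<alpha>J * b) * fix_bracket G E \<phi> B Z" using Z(4) by linarith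
    have last: "2 * y / (\<alpha>J * b) * fix_bracket G E \<phi> B Z
        \<le> 2 ^ 800 * ((K / (\<rho> * \<alpha>J) * max 1 (real (card S) / real (card As))) powr 600
             * (y / real (card S)) * fix_bracket G E \<phi> S Z)" if finS: "finite S"
    proof -
      define s where "s = real (card S)"
      have Sne: "S \<noteq> {}" and BS: "B \<subseteq> S" using Bne by (auto simp: B_def)
      have s: "0 < s" using Sne finS by (simp add: s_def card_gt_0_iff)
      define F where "F = fix_bracket G E \<phi> S Z"
      have F0: "0 \<le> F"
        unfolding F_def fix_bracket_eq[OF S finS Sne ZX Z(2)] by (intro divide_nonneg_nonneg sum_nonneg) auto
      \<comment> \<open>As |S|/|B| equals (|S|/|As|)/\<rho>, it is at most m/\<rho>. With
        \<open>m\<close> at least 1, the quantity \<open>w\<close> dominates x, m/\<rho> and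
        1/\<alpha>J at once.\<close>
      define m where "m = max 1 (s / real (card As))"
      define w where "w = K / (\<rho> * \<alpha>J) * m"
      have m: "1 \<le> m" "s / real (card As) \<le> m" by (auto simp: m_def)
      have w_eq: "w = x * (m / \<rho>)" by (simp add: w_def x_def)
      have mr: "1 \<le> m / \<rho>" using m \<rho>01 by (simp add: pos_le_divide_eq)
      have xw: "x \<le> w" unfolding w_eq using mr x1 by (intro mult_le_cancel_left1[THEN iffD2]) auto
      have mw: "m / \<rho> \<le> w" unfolding w_eq using mr x1 by (intro mult_le_cancel_right1[THEN iffD2]) auto
      have "s / b = (s / real (card As)) / \<rho>" using cAs pos by (simp add: \<rho> b_def)
      also have "\<dots> \<le> m / \<rho>" using m \<rho>01 by (intro divide_right_mono) auto
      finally have sb: "s / b \<le> w" using mw by linarith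
      have aw: "1 / \<alpha>J \<le> w" using ax a0 xw by (simp add: pos_divide_le_eq) (smt (verit) mult.commute mult_left_mono)
      have w1: "1 \<le> w" using xw x1 by linarith
      have "2 * y / (\<alpha>J * b) * fix_bracket G E \<phi> B Z \<le> 2 * y / (\<alpha>J * b) * (s / b * F)"
        using fix_bracket_mono[OF S finS BS Bne ZX Z(2)] pos a0
        unfolding F_def s_def b_def by (intro mult_left_mono) auto
      \<comment> \<open>The ratio |S|/|B| occurs twice: once from replacing |Y|/|B| by |Y|/|S| and
        once from \<open>fix_bracket_mono\<close>.\<close>
      also have "\<dots> = 2 * ((1 / \<alpha>J) * ((s / b) * (s / b))) * (y / s * F)" using s by (simp add: mult_ac)
      also have "\<dots> \<le> 2 ^ 800 * w ^ 600 * (y / s * F)"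
      proof (rule mult_right_mono)
        have "(1 / \<alpha>J) * ((s / b) * (s / b)) \<le> w * (w * w)"
          using aw sb w1 a0 s pos by (intro mult_mono) auto
        also have "\<dots> = w ^ 3" by (simp add: power3_eq_cube)
        also have "\<dots> \<le> w ^ 600" using w1 by (intro power_increasing) auto
        finally show "2 * ((1 / \<alpha>J) * ((s / b) * (s / b))) \<le> 2 ^ 800 * w ^ 600"
          using a0 s pos by (intro mult_mono) auto
      qed (use pos s F0 in auto)
      also have "w ^ 600 = w powr 600" using w1 by (simp add: powr_numeral)
      finally show ?thesis unfolding w_def m_def s_def F_def by (simp only: mult.assoc)
    qed
    show "\<exists>Y' \<subseteq> Y.
            real (card Y') \<ge> \<alpha>J * real (card B) / (2 * real (card (B <#> set_inv B))) * real (card Y) \<and>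
            (\<rho> * \<alpha>J / K) powr 600 * real (card Y)
              \<le> 2 ^ 800 * (\<alpha>J * real (card B) / (2 * real (card (B <#> set_inv B))) * real (card Y)) \<and>
            (\<exists>Z \<subseteq> Y'. Y' \<subseteq> act_image \<phi> (set_inv B <#> B) Z \<and>
              real (card Z) \<le> 2 * real (card Y) / (\<alpha>J * real (card B)) * fix_bracket G E \<phi> B Z \<and>
              (finite S \<longrightarrow>
                2 * real (card Y) / (\<alpha>J * real (card B)) * fix_bracket G E \<phi> B Z
                  \<le> 2 ^ 800 * ((K / (\<rho> * \<alpha>J) * max 1 (real (card S) / real (card As))) powr 600
                         * (real (card Y) / real (card S)) * fix_bracket G E \<phi> S Z)))"
      using Y' Z(1,3) order_trans[OF low Y'(2)] low2 Zle last
      unfolding y_def b_def bb_def by blast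
  qed (use As in auto)
qed

theorem theorem3:
  "\<exists>C>0::real. \<exists>M>0::real.
    \<forall>(G :: 'g monoid) (X :: 'x set) \<phi> Y A (\<alpha> :: real) (J :: nat) (\<alpha>J :: real) (K :: real).
      group_action G X \<phi> \<longrightarrow>
      Y \<subseteq> X \<longrightarrow> finite Y \<longrightarrow> Y \<noteq> {} \<longrightarrow>
      A \<subseteq> carrier G \<longrightarrow> finite A \<longrightarrow> A \<noteq> {} \<longrightarrow>
      0 < \<alpha> \<longrightarrow> \<alpha> < 1 \<longrightarrow> J \<ge> 1 \<longrightarrow>
      \<alpha>J = 2 * (\<alpha> / 2) ^ (2 ^ J) \<longrightarrow>
      finite (sym_set G \<phi> \<alpha>J Y) \<longrightarrow>
      K = (real (card (sym_set G \<phi> \<alpha>J Y)) / real (card A)) powr (1 / real J) \<longrightarrow>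
      A \<subseteq> sym_set G \<phi> \<alpha> Y \<longrightarrow>
      (\<exists>gs \<in> sym_power G A (2 ^ J). \<exists>As. As \<subseteq> carrier G \<and> finite As \<and> As \<noteq> {} \<and>
        (inv\<^bsub>G\<^esub> gs <#\<^bsub>G\<^esub> As \<subseteq> sym_power G A (2 ^ J) \<inter> sym_set G \<phi> \<alpha>J Y \<and>
         real (card (As <#>\<^bsub>G\<^esub> As <#>\<^bsub>G\<^esub> As)) \<le> M * ((K / \<alpha>J) powr C * real (card As)))
        \<and>
        (\<forall>S \<subseteq> carrier G. \<exists>g \<in> sym_power G A (2 ^ (J + 1)).
          (\<alpha>J / K) powr C * (real (card (S \<inter> As)) / real (card As)) * real (card A)
            \<le> M * (real (card (set_inv\<^bsub>G\<^esub> A \<inter> (g <#\<^bsub>G\<^esub> S))) + real (card (A \<inter> (g <#\<^bsub>G\<^esub> S)))))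
        \<and>
        (\<forall>S B \<rho>. S \<subseteq> carrier G \<longrightarrow> B = As \<inter> S \<longrightarrow> B \<noteq> {} \<longrightarrow>
          \<rho> = real (card B) / real (card As) \<longrightarrow>
          (\<exists>Y' \<subseteq> Y.
            real (card Y') \<ge>
              \<alpha>J * real (card B) / (2 * real (card (B <#>\<^bsub>G\<^esub> set_inv\<^bsub>G\<^esub> B))) * real (card Y) \<and>
            (\<rho> * \<alpha>J / K) powr C * real (card Y)
              \<le> M * (\<alpha>J * real (card B) / (2 * real (card (B <#>\<^bsub>G\<^esub> set_inv\<^bsub>G\<^esub> B))) * real (card Y)) \<and>
            (\<exists>Z \<subseteq> Y'. Y' \<subseteq> act_image \<phi> (set_inv\<^bsub>G\<^esub> B <#>\<^bsub>G\<^esub> B) Z \<and>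
              real (card Z) \<le> 2 * real (card Y) / (\<alpha>J * real (card B)) * fix_bracket G X \<phi> B Z \<and>
              (finite S \<longrightarrow>
                2 * real (card Y) / (\<alpha>J * real (card B)) * fix_bracket G X \<phi> B Z
                  \<le> M * ((K / (\<rho> * \<alpha>J) * max 1 (real (card S) / real (card As))) powr C
                         * (real (card Y) / real (card S)) * fix_bracket G X \<phi> S Z))))))"
  by (rule exI[of _ 600], intro conjI exI[of _ "2 ^ 800"] allI impI)
    (rule group_action.sym_set_structure; assumption | simp)+

end
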